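(* Let $A:L^1(\Omega)\to L^\infty(\Gamma)$, $f$, $R$ and $u^\dagger$ be as in the context. Assume there exists $p^\dagger\in L^\infty(\Gamma)$ such that $A^*p^\dagger\in\partial R(u^\dagger)$. Let $\Phi:[0,+\infty)\to[0,+\infty)$ be a strictly increasing, continuous, concave function such that $\Phi(0)=0$ and $$\forall p\in L^\infty(\Gamma),\qquad\int_\Gamma f(t)p^\dagger(t)\,(p^\dagger(t)-p(t))\,dt\le\Phi\big(D_{R^*}(A^*p,A^*p^\dagger)\big).$$ If $R^*$ is twice Fréchet differentiable at $A^*p^\dagger$ and $\Phi(t)\sim t^{\frac12}$ as $t\to0$, then $fp^\dagger\in\operatorname{Ran}(A^{**})$.
   Context: $\Omega,\Gamma\subset\mathbb{R}^2$ are bounded measurable sets. $A:L^1(\Omega)\to L^\infty(\Gamma)$ is linear, compact and ill-posed (i.e. the equation $Au=f$ is ill-posed). The data $f\in L^\infty(\Gamma)$ satisfy $c_1\le f(t)\le c_2$ for a.e. $t\in\Gamma$, for some constants $c_1,c_2>0$. $R:L^1(\Omega)\to\mathbb{R}\cup\{+\infty\}$ is proper, convex and lower semicontinuous, with Fenchel conjugate $R^*$, and $u^\dagger\in\operatorname{arg\,min}\{R(u):Au=f\}$. An element $p\in L^\infty(\Gamma)$ is regarded as the element $z\mapsto\int_\Gamma pz\,dt$ of $(L^\infty(\Gamma))^*$. $A^{**}:(L^1(\Omega))^{**}\to(L^\infty(\Gamma))^{**}$ is the biadjoint, $\operatorname{Ran}$ denotes range, and $fp^\dagger\in L^\infty(\Gamma)$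 (pointwise product) is identified with its image under the canonical embedding $L^\infty(\Gamma)\to(L^\infty(\Gamma))^{**}$. $D_{R^*}(A^*p,A^*p^\dagger)=R^*(A^*p)-R^*(A^*p^\dagger)-\langle u^\dagger,A^*p-A^*p^\dagger\rangle$ (note $u^\dagger\in\partial R^*(A^*p^\dagger)$); the right-hand side of the variational inequality is read as $+\infty$ when $D_{R^*}(A^*p,A^*p^\dagger)=+\infty$. *)

theory Defs
  imports
    "HOL-Analysis.Analysis"
    "HOL-Probability.Essential_Supremum"
    "HOL-Library.Function_Algebras"
    "HOL-Library.Landau_Symbols"
begin

text \<open>
  The spaces below depend on the sets \<open>\<Omega>\<close> and \<open>\<Gamma>\<close>, which are term variables, so they are given by
  a carrier and a seminorm inside an ambient vector space and not as types.  Elements of \<open>L\<^sup>1\<close> and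
  \<open>L\<^sup>\<infinity>\<close> are represented by functions; two functions represent the same element iff their difference
  has seminorm 0.  The ambient vector spaces are function spaces with pointwise operations.
\<close>

instantiation "fun" :: (type, real_vector) real_vector
begin

definition scaleR_fun :: "real \<Rightarrow> ('a \<Rightarrow> 'b) \<Rightarrow> 'a \<Rightarrow> 'b"
  where "scaleR_fun c u = (\<lambda>x. c *\<^sub>R u x)"

instance
  by standard (auto simp: scaleR_fun_def plus_fun_def scaleR_add_right scaleR_add_left)

end

record 'v nspace =
  elems :: "'v set"
  nrm :: "'v \<Rightarrow> real"

definition real_space :: "real nspace"
  where "real_space = \<lparr>elems = UNIV, nrm = abs\<rparr>"

definition L1 :: "'a::euclidean_space set \<Rightarrow> ('a \<Rightarrow> real) nspace"
  where "L1 \<Omega> = \<lparr>elems = {u. integrable (lebesgue_on \<Omega>) u},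
                 nrm = (\<lambda>u. \<integral>x. \<bar>u x\<bar> \<partial>lebesgue_on \<Omega>)\<rparr>"

text \<open>On a null set the essential supremum is \<open>-\<infinity>\<close>, which \<^const>\<open>real_of_ereal\<close> sends to 0.\<close>

definition Linf :: "'a::euclidean_space set \<Rightarrow> ('a \<Rightarrow> real) nspace"
  where "Linf \<Gamma> = \<lparr>elems = {g. g \<in> borel_measurable (lebesgue_on \<Gamma>) \<and>
                              esssup (lebesgue_on \<Gamma>) (\<lambda>t. ereal \<bar>g t\<bar>) < \<infinity>},
                   nrm = (\<lambda>g. real_of_ereal (esssup (lebesgue_on \<Gamma>) (\<lambda>t. ereal \<bar>g t\<bar>)))\<rparr>"

text \<open>Linearity is required modulo seminorm 0, that is, for the represented elements.\<close>

definition linear_op :: "'v::real_vector nspace \<Rightarrow> 'w::real_vector nspace \<Rightarrow> ('v \<Rightarrow> 'w) \<Rightarrow> bool"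
  where "linear_op X Y T \<longleftrightarrow>
    T \<in> elems X \<rightarrow> elems Y \<and>
    (\<forall>u\<in>elems X. \<forall>v\<in>elems X. nrm Y (T (u + v) - (T u + T v)) = 0) \<and>
    (\<forall>c. \<forall>u\<in>elems X. nrm Y (T (c *\<^sub>R u) - c *\<^sub>R T u) = 0)"

definition bounded_linear_op :: "'v::real_vector nspace \<Rightarrow> 'w::real_vector nspace \<Rightarrow> ('v \<Rightarrow> 'w) \<Rightarrow> bool"
  where "bounded_linear_op X Y T \<longleftrightarrow>
    linear_op X Y T \<and> (\<exists>C. \<forall>u\<in>elems X. nrm Y (T u) \<le> C * nrm X u)"

text \<open>Every bounded sequence is mapped to a sequence with a norm convergent subsequence.\<close>

definition compact_op :: "'v::real_vector nspace \<Rightarrow> 'w::real_vector nspace \<Rightarrow> ('v \<Rightarrow> 'w) \<Rightarrow> bool"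
  where "compact_op X Y T \<longleftrightarrow>
    (\<forall>s C. (\<forall>n::nat. s n \<in> elems X \<and> nrm X (s n) \<le> C) \<longrightarrow>
      (\<exists>r. \<exists>y\<in>elems Y. strict_mono r \<and> (\<lambda>n. nrm Y (T (s (r n)) - y)) \<longlonglongrightarrow> 0))"

text \<open>Well-posedness of the equation with operator \<open>T\<close> in the sense of Hadamard:
  existence, uniqueness and continuous dependence of the solution on the data.\<close>

definition well_posed :: "'v::real_vector nspace \<Rightarrow> 'w::real_vector nspace \<Rightarrow> ('v \<Rightarrow> 'w) \<Rightarrow> bool"
  where "well_posed X Y T \<longleftrightarrow>
    (\<forall>g\<in>elems Y. \<exists>u\<in>elems X. nrm Y (T u - g) = 0) \<and>
    (\<forall>u\<in>elems X. \<forall>v\<in>elems X. nrm Y (T u - T v) = 0 \<longrightarrow> nrm X (u - v) = 0) \<and>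
    (\<forall>s. \<forall>u\<in>elems X. (\<forall>n::nat. s n \<in> elems X) \<and> (\<lambda>n. nrm Y (T (s n) - T u)) \<longlonglongrightarrow> 0
      \<longrightarrow> (\<lambda>n. nrm X (s n - u)) \<longlonglongrightarrow> 0)"

abbreviation ill_posed :: "'v::real_vector nspace \<Rightarrow> 'w::real_vector nspace \<Rightarrow> ('v \<Rightarrow> 'w) \<Rightarrow> bool"
  where "ill_posed X Y T \<equiv> \<not> well_posed X Y T"

text \<open>Functionals are set to 0 outside the carrier, so that equal functionals are equal functions.\<close>

definition dual :: "'v::real_vector nspace \<Rightarrow> ('v \<Rightarrow> real) nspace"
  where "dual X = \<lparr>elems = {\<phi>. bounded_linear_op X real_space \<phi> \<and> (\<forall>u. u \<notin> elems X \<longrightarrow> \<phi> u = 0)},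
                   nrm = (\<lambda>\<phi>. Sup {\<bar>\<phi> u\<bar> | u. u \<in> elems X \<and> nrm X u \<le> 1})\<rparr>"

text \<open>For \<open>T\<close> from \<open>X\<close> to \<open>Y\<close>, \<open>dual_op X T\<close> is the adjoint from \<open>dual Y\<close> to \<open>dual X\<close>.\<close>

definition dual_op :: "'v nspace \<Rightarrow> ('v \<Rightarrow> 'w) \<Rightarrow> ('w \<Rightarrow> real) \<Rightarrow> 'v \<Rightarrow> real"
  where "dual_op X T \<psi> = (\<lambda>u. if u \<in> elems X then \<psi> (T u) else 0)"

definition bidual_op :: "'v nspace \<Rightarrow> 'w::real_vector nspace \<Rightarrow> ('v \<Rightarrow> 'w) \<Rightarrow>
    (('v \<Rightarrow> real) \<Rightarrow> real) \<Rightarrow> ('w \<Rightarrow> real) \<Rightarrow> real"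
  where "bidual_op X Y T = dual_op (dual Y) (dual_op X T)"

definition canonical_embedding :: "'v::real_vector nspace \<Rightarrow> 'v \<Rightarrow> ('v \<Rightarrow> real) \<Rightarrow> real"
  where "canonical_embedding X v = (\<lambda>\<phi>. if \<phi> \<in> elems (dual X) then \<phi> v else 0)"

text \<open>The element of the dual of \<open>L\<^sup>\<infinity>\<close> given by integration against \<open>p\<close>.\<close>

definition Linf_functional :: "'a::euclidean_space set \<Rightarrow> ('a \<Rightarrow> real) \<Rightarrow> ('a \<Rightarrow> real) \<Rightarrow> real"
  where "Linf_functional \<Gamma> p =
    (\<lambda>z. if z \<in> elems (Linf \<Gamma>) then \<integral>t. p t * z t \<partial>lebesgue_on \<Gamma> else 0)"

definition proper_on :: "'v nspace \<Rightarrow> ('v \<Rightarrow> ereal) \<Rightarrow> bool"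
  where "proper_on X F \<longleftrightarrow> (\<forall>u\<in>elems X. F u \<noteq> -\<infinity>) \<and> (\<exists>u\<in>elems X. F u \<noteq> \<infinity>)"

definition convex_functional :: "'v::real_vector nspace \<Rightarrow> ('v \<Rightarrow> ereal) \<Rightarrow> bool"
  where "convex_functional X F \<longleftrightarrow>
    (\<forall>u\<in>elems X. \<forall>v\<in>elems X. \<forall>t\<in>{0..1}.
      F (t *\<^sub>R u + (1 - t) *\<^sub>R v) \<le> ereal t * F u + ereal (1 - t) * F v)"

text \<open>Lower semicontinuity implies in particular that \<open>F\<close> is constant on classes modulo seminorm 0.\<close>

definition lsc_functional :: "'v::real_vector nspace \<Rightarrow> ('v \<Rightarrow> ereal) \<Rightarrow> bool"
  where "lsc_functional X F \<longleftrightarrow>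
    (\<forall>u\<in>elems X. \<forall>a<F u. \<exists>\<delta>>0. \<forall>v\<in>elems X. nrm X (v - u) < \<delta> \<longrightarrow> a < F v)"

definition fenchel_conjugate :: "'v nspace \<Rightarrow> ('v \<Rightarrow> ereal) \<Rightarrow> ('v \<Rightarrow> real) \<Rightarrow> ereal"
  where "fenchel_conjugate X F \<xi> = (SUP u\<in>elems X. ereal (\<xi> u) - F u)"

definition subdifferential :: "'v::real_vector nspace \<Rightarrow> ('v \<Rightarrow> ereal) \<Rightarrow> 'v \<Rightarrow> ('v \<Rightarrow> real) set"
  where "subdifferential X F u =
    {\<xi> \<in> elems (dual X). \<forall>v\<in>elems X. F u + ereal (\<xi> (v - u)) \<le> F v}"

text \<open>Bregman distance of a functional \<open>G\<close> on the dual space, where the subgradient of \<open>G\<close> at \<open>\<eta>\<close>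
  is the element \<open>u\<close> of the predual.\<close>

definition bregman_dist :: "(('v \<Rightarrow> real) \<Rightarrow> ereal) \<Rightarrow> 'v \<Rightarrow> ('v \<Rightarrow> real) \<Rightarrow> ('v \<Rightarrow> real) \<Rightarrow> ereal"
  where "bregman_dist G u \<xi> \<eta> = G \<xi> - G \<eta> - ereal (\<xi> u - \<eta> u)"

definition has_frechet_derivative ::
    "'v::real_vector nspace \<Rightarrow> 'w::real_vector nspace \<Rightarrow> ('v \<Rightarrow> 'w) \<Rightarrow> ('v \<Rightarrow> 'w) \<Rightarrow> 'v \<Rightarrow> bool"
  where "has_frechet_derivative X Y F T x \<longleftrightarrow>
    bounded_linear_op X Y T \<and>
    (\<forall>\<epsilon>>0. \<exists>\<delta>>0. \<forall>h\<in>elems X. nrm X h < \<delta> \<longrightarrow> nrm Y (F (x + h) - F x - T h) \<le> \<epsilon> * nrm X h)"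

text \<open>The functional is finite and Fr\'echet differentiable near \<open>x\<close>, and its derivative \<open>D\<close>, as a
  map into the dual space, is Fr\'echet differentiable at \<open>x\<close>.\<close>

definition twice_frechet_differentiable :: "'v::real_vector nspace \<Rightarrow> ('v \<Rightarrow> ereal) \<Rightarrow> 'v \<Rightarrow> bool"
  where "twice_frechet_differentiable X F x \<longleftrightarrow>
    (\<exists>r>0. \<exists>D T.
      (\<forall>y\<in>elems X. nrm X (y - x) < r \<longrightarrow>
        \<bar>F y\<bar> \<noteq> \<infinity> \<and> D y \<in> elems (dual X) \<and>
        has_frechet_derivative X real_space (\<lambda>z. real_of_ereal (F z)) (D y) y) \<and>
      has_frechet_derivative X (dual X) D T x)"

end

theory Submission
  imports Defs
begin

text \<open>
  By the Hahn-Banach theorem an element \<open>w\<close> of \<open>Y\<close> lies in the range of the biadjoint of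
  \<open>T : X \<rightarrow> Y\<close> as soon as \<open>\<psi> w \<le> C * \<parallel>T\<^sup>* \<psi>\<parallel>\<close> for all \<open>\<psi>\<close> in the dual of \<open>Y\<close>: then \<open>T\<^sup>* \<psi> \<mapsto> \<psi> w\<close> is well defined
  and bounded on the range of the adjoint, and any bounded extension of it is a preimage
  (\<open>canonical_embedding_in_range_bidual_op\<close>).  So the theorem is an estimate for \<open>w = f p\<^sub>d\<close>.
  
  For the functionals \<open>\<psi>\<close> given by a density \<open>p\<close> in \<open>L\<^sup>\<infinity>\<close> the estimate comes from the variational
  inequality.  Since \<open>u\<^sub>d\<close> is a subgradient of \<open>R\<^sup>*\<close> at \<open>A\<^sup>* p\<^sub>d\<close>, it is the derivative of \<open>R\<^sup>*\<close> there, and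
  as the derivative of \<open>R\<^sup>*\<close> is itself differentiable, the Bregman distance from \<open>A\<^sup>* p\<^sub>d\<close> to
  \<open>A\<^sup>* p\<^sub>d + h\<close> is at most \<open>K * \<parallel>h\<parallel>\<^sup>2\<close> for small \<open>h\<close> (\<open>quadratic_bound_at_subgradient\<close>).  The function \<open>\<Phi>\<close>
  behaves like a square root, so testing with \<open>p\<^sub>d - s p\<close> gives \<open>s * \<integral> p w \<le> c * sqrt K * s * \<parallel>A\<^sup>* p\<parallel>\<close> for
  small \<open>s > 0\<close>, and \<open>s\<close> cancels (\<open>square_root_rate_imp_linear_bound\<close>).
  
  The densities are in general not norm dense in the dual of \<open>L\<^sup>\<infinity>\<close>, and it is the compactness of \<open>A\<close> that extends the
  estimate to all \<open>\<psi>\<close> (\<open>dual_bound_from_densities\<close>).  On finitely many functions, any \<open>\<psi>\<close> can be imitated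
  by a density \<open>p\<close> of no larger norm (\<open>dual_Linf_approx_by_density\<close>).  The image of the unit ball
  under \<open>A\<close> is totally bounded, so finitely many functions suffice to make \<open>A\<^sup>* p\<close> close to
  \<open>A\<^sup>* \<psi>\<close> in norm, while \<open>\<integral> p w\<close> is close to \<open>\<psi> w\<close>.
\<close>

section \<open>Seminormed carriers and their duals\<close>

lemma scaleR_fun_apply [simp]: "(c *\<^sub>R u) x = c *\<^sub>R u x"
  by (simp add: scaleR_fun_def)

text \<open>
  The axioms ask for a seminorm only: representatives of the zero class have seminorm 0, and
  passing to the quotient is never necessary, because elements of the dual are constant on classes.
\<close>

locale seminormed =
  fixes X :: "'v::real_vector nspace"
  assumes subspace_elems: "subspace (elems X)"
    and nrm_triangle: "\<lbrakk>u \<in> elems X; v \<in> elems X\<rbrakk> \<Longrightarrow> nrm X (u + v) \<le> nrm X u + nrm X v"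
    and nrm_scaleR: "u \<in> elems X \<Longrightarrow> nrm X (c *\<^sub>R u) = \<bar>c\<bar> * nrm X u"
begin

lemma zero_mem [simp]: "0 \<in> elems X"
  using subspace_elems by (rule subspace_0)

lemma add_mem [simp]: "\<lbrakk>u \<in> elems X; v \<in> elems X\<rbrakk> \<Longrightarrow> u + v \<in> elems X"
  using subspace_elems by (rule subspace_add)

lemma scaleR_mem [simp]: "u \<in> elems X \<Longrightarrow> c *\<^sub>R u \<in> elems X"
  using subspace_elems by (rule subspace_scale)

lemma diff_mem [simp]: "\<lbrakk>u \<in> elems X; v \<in> elems X\<rbrakk> \<Longrightarrow> u - v \<in> elems X"
  using subspace_elems by (rule subspace_diff)

lemma nrm_zero [simp]: "nrm X 0 = 0"
  using nrm_scaleR[of 0 0] by simp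

lemma nrm_minus: "u \<in> elems X \<Longrightarrow> nrm X (- u) = nrm X u"
  using nrm_scaleR[of u "-1"] by simp

lemma nrm_nonneg: "u \<in> elems X \<Longrightarrow> 0 \<le> nrm X u"
  using nrm_triangle[of u "- u"] nrm_minus[of u] subspace_neg[OF subspace_elems] by simp

lemma nrm_diff_commute:
  "\<lbrakk>u \<in> elems X; v \<in> elems X\<rbrakk> \<Longrightarrow> nrm X (u - v) = nrm X (v - u)"
  using nrm_minus[of "u - v"] by simp

lemma nrm_triangle_diff:
  "\<lbrakk>u \<in> elems X; v \<in> elems X\<rbrakk> \<Longrightarrow> nrm X u \<le> nrm X (u - v) + nrm X v"
  using nrm_triangle[of "u - v" v] by simp

end

lemma mem_dual_iff:
  "\<phi> \<in> elems (dual X) \<longleftrightarrow>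
    (\<forall>u\<in>elems X. \<forall>v\<in>elems X. \<phi> (u + v) = \<phi> u + \<phi> v) \<and>
    (\<forall>c. \<forall>u\<in>elems X. \<phi> (c *\<^sub>R u) = c * \<phi> u) \<and>
    (\<exists>C. \<forall>u\<in>elems X. \<bar>\<phi> u\<bar> \<le> C * nrm X u) \<and>
    (\<forall>u. u \<notin> elems X \<longrightarrow> \<phi> u = 0)"
  unfolding dual_def bounded_linear_op_def linear_op_def real_space_def by auto

lemma dualI:
  assumes "\<And>u v. \<lbrakk>u \<in> elems X; v \<in> elems X\<rbrakk> \<Longrightarrow> \<phi> (u + v) = \<phi> u + \<phi> v"
    and "\<And>c u. u \<in> elems X \<Longrightarrow> \<phi> (c *\<^sub>R u) = c * \<phi> u"
    and "\<And>u. u \<in> elems X \<Longrightarrow> \<bar>\<phi> u\<bar> \<le> C * nrm X u"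
    and "\<And>u. u \<notin> elems X \<Longrightarrow> \<phi> u = 0"
  shows "\<phi> \<in> elems (dual X)"
  unfolding mem_dual_iff using assms by blast

lemma dual_add: "\<lbrakk>\<phi> \<in> elems (dual X); u \<in> elems X; v \<in> elems X\<rbrakk> \<Longrightarrow> \<phi> (u + v) = \<phi> u + \<phi> v"
  and dual_scaleR: "\<lbrakk>\<phi> \<in> elems (dual X); u \<in> elems X\<rbrakk> \<Longrightarrow> \<phi> (c *\<^sub>R u) = c * \<phi> u"
  by (auto simp: mem_dual_iff)

context seminormed
begin

lemma dual_zero: "\<phi> \<in> elems (dual X) \<Longrightarrow> \<phi> 0 = 0"
  using dual_scaleR[of \<phi> X 0 0] by simp

lemma dual_diff: "\<lbrakk>\<phi> \<in> elems (dual X); u \<in> elems X; v \<in> elems X\<rbrakk> \<Longrightarrow> \<phi> (u - v) = \<phi> u - \<phi> v"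
  using dual_add[of \<phi> X "u - v" v] by simp

lemma dual_sum:
  assumes "\<phi> \<in> elems (dual X)" "\<And>i. i \<in> I \<Longrightarrow> g i \<in> elems X"
  shows "\<phi> (\<Sum>i\<in>I. g i) = (\<Sum>i\<in>I. \<phi> (g i))"
  using assms(2)
proof (induction I rule: infinite_finite_induct)
  case (insert i I)
  then have "(\<Sum>j\<in>I. g j) \<in> elems X"
    by (intro subspace_sum[OF subspace_elems]) auto
  with insert show ?case
    by (simp add: dual_add[OF assms(1)])
qed (simp_all add: dual_zero[OF assms(1)])

lemma nrm_dual_le:
  assumes "\<And>u. u \<in> elems X \<Longrightarrow> nrm X u \<le> 1 \<Longrightarrow> \<bar>\<phi> u\<bar> \<le> C"
  shows "nrm (dual X) \<phi> \<le> C"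
proof -
  have "nrm X 0 \<le> 1" by simp
  then have "{\<bar>\<phi> u\<bar> |u. u \<in> elems X \<and> nrm X u \<le> 1} \<noteq> {}"
    using zero_mem by blast
  then show ?thesis
    unfolding dual_def using assms by (auto intro!: cSup_least)
qed

lemma dual_le_unit_ball:
  assumes "\<phi> \<in> elems (dual X)" "u \<in> elems X" "nrm X u \<le> 1"
  shows "\<bar>\<phi> u\<bar> \<le> nrm (dual X) \<phi>"
proof -
  obtain C where C: "\<And>u. u \<in> elems X \<Longrightarrow> \<bar>\<phi> u\<bar> \<le> C * nrm X u"
    using assms(1) unfolding mem_dual_iff by blast
  have "\<bar>\<phi> v\<bar> \<le> \<bar>C\<bar>" if "v \<in> elems X" "nrm X v \<le> 1" for v
  proof -
    have "\<bar>\<phi> v\<bar> \<le> C * nrm X v" by (rule C[OF that(1)])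
    also have "\<dots> \<le> \<bar>C\<bar> * nrm X v"
      by (intro mult_right_mono nrm_nonneg that) auto
    also have "\<dots> \<le> \<bar>C\<bar>"
      using that by (simp add: mult_left_le)
    finally show ?thesis .
  qed
  then show ?thesis
    unfolding dual_def using assms by (auto intro!: cSup_upper bdd_aboveI[where M="\<bar>C\<bar>"])
qed

lemma dual_le:
  assumes \<phi>: "\<phi> \<in> elems (dual X)" and u: "u \<in> elems X"
  shows "\<bar>\<phi> u\<bar> \<le> nrm (dual X) \<phi> * nrm X u"
proof (cases "nrm X u = 0")
  case True
  then show ?thesis
    using \<phi> u unfolding mem_dual_iff by fastforce
next
  case False
  then have pos: "nrm X u > 0" using nrm_nonneg[OF u] by simp
  have "\<bar>\<phi> ((1 / nrm X u) *\<^sub>R u)\<bar> \<le> nrm (dual X) \<phi>"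
    using pos by (intro dual_le_unit_ball \<phi>) (auto simp: u nrm_scaleR)
  then show ?thesis
    using pos by (simp add: dual_scaleR[OF \<phi> u] abs_mult field_simps)
qed

lemma nrm_dual_nonneg: "\<phi> \<in> elems (dual X) \<Longrightarrow> 0 \<le> nrm (dual X) \<phi>"
  using dual_le_unit_ball[of \<phi> 0] by (simp add: order_trans[OF abs_ge_zero])

lemma dual_cong:
  "\<lbrakk>\<phi> \<in> elems (dual X); u \<in> elems X; v \<in> elems X; nrm X (u - v) = 0\<rbrakk> \<Longrightarrow> \<phi> u = \<phi> v"
  using dual_le[of \<phi> "u - v"] by (simp add: dual_diff)

lemma subspace_dual: "subspace (elems (dual X))"
proof (rule subspaceI)
  show "0 \<in> elems (dual X)"
    by (rule dualI[where C=0]) auto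
next
  fix \<phi> \<psi> assume *: "\<phi> \<in> elems (dual X)" "\<psi> \<in> elems (dual X)"
  show "\<phi> + \<psi> \<in> elems (dual X)"
  proof (rule dualI[where C="nrm (dual X) \<phi> + nrm (dual X) \<psi>"])
    fix u assume "u \<in> elems X"
    then show "\<bar>(\<phi> + \<psi>) u\<bar> \<le> (nrm (dual X) \<phi> + nrm (dual X) \<psi>) * nrm X u"
      using dual_le[OF *(1), of u] dual_le[OF *(2), of u] by (simp add: distrib_right)
  qed (use * in \<open>auto simp: mem_dual_iff algebra_simps\<close>)
next
  fix c \<phi> assume *: "\<phi> \<in> elems (dual X)"
  show "c *\<^sub>R \<phi> \<in> elems (dual X)"
  proof (rule dualI[where C="\<bar>c\<bar> * nrm (dual X) \<phi>"])
    fix u assume "u \<in> elems X"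
    then show "\<bar>(c *\<^sub>R \<phi>) u\<bar> \<le> \<bar>c\<bar> * nrm (dual X) \<phi> * nrm X u"
      using mult_left_mono[OF dual_le[OF *, of u], of "\<bar>c\<bar>"] by (simp add: abs_mult mult.assoc)
  qed (use * in \<open>auto simp: mem_dual_iff algebra_simps\<close>)
qed

lemma seminormed_dual: "seminormed (dual X)"
proof
  show "subspace (elems (dual X))" by (rule subspace_dual)
next
  fix \<phi> \<psi> assume *: "\<phi> \<in> elems (dual X)" "\<psi> \<in> elems (dual X)"
  show "nrm (dual X) (\<phi> + \<psi>) \<le> nrm (dual X) \<phi> + nrm (dual X) \<psi>"
  proof (rule nrm_dual_le)
    fix u assume "u \<in> elems X" "nrm X u \<le> 1"
    then show "\<bar>(\<phi> + \<psi>) u\<bar> \<le> nrm (dual X) \<phi> + nrm (dual X) \<psi>"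
      using dual_le_unit_ball[OF *(1), of u] dual_le_unit_ball[OF *(2), of u] by simp
  qed
next
  have le: "nrm (dual X) (c *\<^sub>R \<phi>) \<le> \<bar>c\<bar> * nrm (dual X) \<phi>" if "\<phi> \<in> elems (dual X)" for c \<phi>
    using dual_le_unit_ball[OF that] by (intro nrm_dual_le) (simp add: abs_mult mult_left_mono)
  fix c \<phi> assume *: "\<phi> \<in> elems (dual X)"
  show "nrm (dual X) (c *\<^sub>R \<phi>) = \<bar>c\<bar> * nrm (dual X) \<phi>"
  proof (cases "c = 0")
    case True
    have "nrm (dual X) 0 = 0"
      using le[OF *, of 0] nrm_dual_nonneg[OF subspace_0[OF subspace_dual]] by simp
    then show ?thesis using True by simp
  next
    case False
    have "nrm (dual X) \<phi> \<le> \<bar>1 / c\<bar> * nrm (dual X) (c *\<^sub>R \<phi>)"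
      using le[OF subspace_scale[OF subspace_dual *, of c], of "1 / c"] False by simp
    then show ?thesis
      using le[OF *, of c] False by (simp add: field_simps)
  qed
qed

end

section \<open>Dominated extension of functionals\<close>

text \<open>
  The Hahn-Banach theorem, with linear functionals encoded as graphs, that is, as subspaces \<open>G\<close> of
  the product with the reals.  If \<open>a \<le> q x\<close> for all \<open>(x, a)\<close> in \<open>G\<close>, then \<open>G\<close> is single-valued,
  since \<open>(0, a)\<close> and \<open>(0, - a)\<close> in \<open>G\<close> give \<open>a = 0\<close>.  So domination alone is preserved in Zorn's
  lemma, and the functional to be extended is a priori only a relation: in the application below this
  includes its well-definedness on the range of an adjoint operator.
\<close>

theorem dominated_extension:
  fixes S :: "'a::real_vector set" and G\<^sub>0 :: "('a \<times> real) set"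
  assumes S: "subspace S"
    and q_add: "\<And>x y. \<lbrakk>x \<in> S; y \<in> S\<rbrakk> \<Longrightarrow> q (x + y) \<le> q x + q y"
    and q_scale: "\<And>c x. \<lbrakk>x \<in> S; 0 \<le> c\<rbrakk> \<Longrightarrow> q (c *\<^sub>R x) = c * q x"
    and G0: "subspace G\<^sub>0" "\<And>x a. (x, a) \<in> G\<^sub>0 \<Longrightarrow> x \<in> S \<and> a \<le> q x"
  obtains g where "\<And>x y. \<lbrakk>x \<in> S; y \<in> S\<rbrakk> \<Longrightarrow> g (x + y) = g x + g y"
    and "\<And>c x. x \<in> S \<Longrightarrow> g (c *\<^sub>R x) = c * g x"
    and "\<And>x. x \<in> S \<Longrightarrow> g x \<le> q x"
    and "\<And>x a. (x, a) \<in> G\<^sub>0 \<Longrightarrow> g x = a"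
proof -
  define \<A> where "\<A> = {G. subspace G \<and> G\<^sub>0 \<subseteq> G \<and> (\<forall>(x, a)\<in>G. x \<in> S \<and> a \<le> q x)}"
  have "G\<^sub>0 \<in> \<A>" using G0 by (auto simp: \<A>_def)
  moreover have "\<Union>\<C> \<in> \<A>" if "\<C> \<noteq> {}" "subset.chain \<A> \<C>" for \<C>
  proof -
    have sub: "subspace G" if "G \<in> \<C>" for G
      using \<open>subset.chain \<A> \<C>\<close> that by (auto simp: subset_chain_def \<A>_def)
    have "subspace (\<Union>\<C>)"
    proof (rule subspaceI)
      show "0 \<in> \<Union>\<C>" using \<open>\<C> \<noteq> {}\<close> sub subspace_0 by fastforce
    next
      fix x y assume "x \<in> \<Union>\<C>" "y \<in> \<Union>\<C>"
      then obtain G H where GH: "G \<in> \<C>" "H \<in> \<C>" "x \<in> G" "y \<in> H" by blast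
      then have "G \<subseteq> H \<or> H \<subseteq> G"
        using that by (auto simp: subset_chain_def)
      then show "x + y \<in> \<Union>\<C>"
        using GH sub by (meson UnionI subspace_add subsetD)
    next
      fix c x assume "x \<in> \<Union>\<C>"
      then show "c *\<^sub>R x \<in> \<Union>\<C>" using sub subspace_scale by blast
    qed
    moreover have "G\<^sub>0 \<subseteq> \<Union>\<C>" "\<forall>(x, a)\<in>\<Union>\<C>. x \<in> S \<and> a \<le> q x"
      using that by (fastforce simp: subset_chain_def \<A>_def)+
    ultimately show ?thesis by (simp add: \<A>_def)
  qed
  ultimately obtain G where G: "G \<in> \<A>" and max: "\<And>H. H \<in> \<A> \<Longrightarrow> G \<subseteq> H \<Longrightarrow> H = G"
    using subset_Zorn_nonempty[of \<A>] by blast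
  have subG: "subspace G" and G0G: "G\<^sub>0 \<subseteq> G"
    and GS: "\<And>x a. (x, a) \<in> G \<Longrightarrow> x \<in> S" and Gq: "\<And>x a. (x, a) \<in> G \<Longrightarrow> a \<le> q x"
    using G by (auto simp: \<A>_def)
  have q0: "q 0 = 0" using q_scale[of 0 0] subspace_0[OF S] by simp
  have single: "a = b" if "(x, a) \<in> G" "(x, b) \<in> G" for x a b
    using Gq[of 0 "a - b"] Gq[of 0 "b - a"] q0
      subspace_diff[OF subG that] subspace_diff[OF subG that(2,1)] by auto
  have dom: "\<exists>a. (x, a) \<in> G" if x: "x \<in> S" for x
  proof -
    \<comment> \<open>The value \<open>a\<close> at \<open>x\<close> must lie between all \<open>b - q (y - x)\<close> and all \<open>q (y + x) - b\<close>.\<close>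
    define L where "L = {b - q (y - x) |y b. (y, b) \<in> G}"
    define a where "a = Sup L"
    have LU: "b - q (y - x) \<le> q (y' + x) - b'" if "(y, b) \<in> G" "(y', b') \<in> G" for y b y' b'
    proof -
      have "b + b' \<le> q ((y - x) + (y' + x))"
        using Gq[of "y + y'" "b + b'"] subspace_add[OF subG that] by simp
      also have "\<dots> \<le> q (y - x) + q (y' + x)"
        using that GS x S by (intro q_add) (auto intro: subspace_diff subspace_add)
      finally show ?thesis by simp
    qed
    have zero: "(0, 0) \<in> G" using subspace_0[OF subG] by (simp add: zero_prod_def)
    have bdd: "bdd_above L"
      by (rule bdd_aboveI[where M="q (0 + x) - 0"]) (use LU[OF _ zero] in \<open>auto simp: L_def\<close>)
    have lower: "b - q (y - x) \<le> a" if "(y, b) \<in> G" for y b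
      unfolding a_def by (rule cSup_upper[OF _ bdd]) (use that in \<open>auto simp: L_def\<close>)
    have upper: "a \<le> q (y + x) - b" if "(y, b) \<in> G" for y b
      unfolding a_def by (rule cSup_least) (use that LU zero in \<open>auto simp: L_def\<close>)
    have bound: "y + k *\<^sub>R x \<in> S \<and> b + k * a \<le> q (y + k *\<^sub>R x)" if yb: "(y, b) \<in> G" for y b k
    proof
      show "y + k *\<^sub>R x \<in> S"
        using GS[OF yb] x S by (auto intro: subspace_add subspace_scale)
      \<comment> \<open>For \<open>k \<noteq> 0\<close> positive homogeneity reduces the claim to \<open>k = \<plusminus>1\<close>.\<close>
      have scaled: "((1 / c) *\<^sub>R y, b / c) \<in> G" for c
        using subspace_scale[OF subG yb, of "1 / c"] by simp
      consider "k = 0" | "k > 0" | "k < 0" by linarith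
      then show "b + k * a \<le> q (y + k *\<^sub>R x)"
      proof cases
        case 1
        then show ?thesis using Gq[OF yb] by simp
      next
        case 2
        have "b + k * a = k * (b / k + a)" using 2 by (simp add: field_simps)
        also have "\<dots> \<le> k * q ((1 / k) *\<^sub>R y + x)"
          using upper[OF scaled[of k]] 2 by (intro mult_left_mono) auto
        also have "\<dots> = q (k *\<^sub>R ((1 / k) *\<^sub>R y + x))"
          using 2 GS[OF scaled] x S by (intro q_scale[symmetric]) (auto intro: subspace_add)
        finally show ?thesis using 2 by (simp add: scaleR_add_right)
      next
        case 3
        have "b + k * a = (- k) * (b / (- k) - a)" using 3 by (simp add: field_simps)
        also have "\<dots> \<le> (- k) * q ((1 / (- k)) *\<^sub>R y - x)"
          using lower[OF scaled[of "- k"]] 3 by (intro mult_left_mono) auto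
        also have "\<dots> = q ((- k) *\<^sub>R ((1 / (- k)) *\<^sub>R y - x))"
          using 3 by (intro q_scale[symmetric] subspace_diff[OF S GS[OF scaled] x]) simp
        finally show ?thesis using 3 by (simp add: scaleR_diff_right)
      qed
    qed
    define H where "H = span (insert (x, a) G)"
    have "H \<in> \<A>"
    proof -
      have "z \<in> S \<and> c \<le> q z" if "(z, c) \<in> H" for z c
      proof -
        obtain k where "(z, c) - k *\<^sub>R (x, a) \<in> span G"
          using \<open>(z, c) \<in> H\<close> by (auto simp: H_def span_insert)
        then have "(z - k *\<^sub>R x, c - k * a) \<in> G"
          using subG by (simp add: span_eq_iff[THEN iffD2])
        from bound[OF this, of k] show ?thesis by simp
      qed
      then show ?thesis
        using G0G span_superset[of "insert (x, a) G"] by (auto simp: \<A>_def H_def)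
    qed
    moreover have "G \<subseteq> H" "(x, a) \<in> H"
      using span_superset[of "insert (x, a) G"] by (auto simp: H_def)
    ultimately show ?thesis using max by blast
  qed
  define g where "g x = (THE a. (x, a) \<in> G)" for x
  have g: "g x = a" if "(x, a) \<in> G" for x a
    unfolding g_def using that single by blast
  show ?thesis
  proof (rule that[of g])
    fix x y assume "x \<in> S" "y \<in> S"
    then obtain a b where ab: "(x, a) \<in> G" "(y, b) \<in> G" using dom by blast
    then show "g (x + y) = g x + g y"
      using subspace_add[OF subG ab] by (simp add: g)
  next
    fix c x assume "x \<in> S"
    then obtain a where a: "(x, a) \<in> G" using dom by blast
    then show "g (c *\<^sub>R x) = c * g x"
      using subspace_scale[OF subG a, of c] by (simp add: g)
  next
    fix x assume "x \<in> S"
    then obtain a where a: "(x, a) \<in> G" using dom by blast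
    then show "g x \<le> q x" using Gq by (simp add: g)
  next
    fix x a assume "(x, a) \<in> G\<^sub>0"
    then show "g x = a" using G0G g by blast
  qed
qed

section \<open>Compact operators\<close>

lemma compact_op_unit_ball_bounded:
  assumes "seminormed X" "seminormed Y" and T: "linear_op X Y T" "compact_op X Y T"
  obtains B where "\<And>u. u \<in> elems X \<Longrightarrow> nrm X u \<le> 1 \<Longrightarrow> nrm Y (T u) \<le> B"
proof -
  interpret Y: seminormed Y by fact
  have TY: "T u \<in> elems Y" if "u \<in> elems X" for u
    using T(1) that by (auto simp: linear_op_def)
  have False if "\<nexists>B. \<forall>u\<in>elems X. nrm X u \<le> 1 \<longrightarrow> nrm Y (T u) \<le> B"
  proof -
    have "\<forall>n. \<exists>u. u \<in> elems X \<and> nrm X u \<le> 1 \<and> nrm Y (T u) > real n"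
      using that by (meson not_le)
    then obtain s where s: "\<And>n. s n \<in> elems X" "\<And>n. nrm X (s n) \<le> 1" "\<And>n. nrm Y (T (s n)) > real n"
      by metis
    then obtain r y where r: "strict_mono r" and y: "y \<in> elems Y"
      and lim: "(\<lambda>n. nrm Y (T (s (r n)) - y)) \<longlonglongrightarrow> 0"
      using T(2) unfolding compact_op_def by metis
    from lim have "eventually (\<lambda>n. nrm Y (T (s (r n)) - y) < 1) sequentially"
      by (rule order_tendstoD) simp
    moreover have "eventually (\<lambda>n. real n > nrm Y y + 1) sequentially"
      using filterlim_real_sequentially by (simp add: filterlim_at_top_dense)
    ultimately have "eventually (\<lambda>n. False) sequentially"
    proof eventually_elim
      case (elim n)
      have "real n \<le> real (r n)" using strict_mono_imp_increasing[OF r] by simp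
      also have "\<dots> < nrm Y (T (s (r n)))" by (rule s)
      also have "\<dots> \<le> nrm Y (T (s (r n)) - y) + nrm Y y"
        by (intro Y.nrm_triangle_diff TY s y)
      finally show False using elim by simp
    qed
    then show False by simp
  qed
  then show ?thesis using that by blast
qed

text \<open>
  The operator is linear only modulo seminorm 0, and an element of seminorm 0 need not be zero, so that
  normalising \<open>u\<close> is possible only when its seminorm is positive.
\<close>

lemma compact_op_imp_bounded:
  assumes X: "seminormed X" and Y: "seminormed Y" and T: "linear_op X Y T" "compact_op X Y T"
  obtains B where "\<And>u. u \<in> elems X \<Longrightarrow> nrm Y (T u) \<le> B * nrm X u"
proof -
  interpret X: seminormed X by fact
  interpret Y: seminormed Y by fact
  obtain B where B: "\<And>u. u \<in> elems X \<Longrightarrow> nrm X u \<le> 1 \<Longrightarrow> nrm Y (T u) \<le> B"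
    using compact_op_unit_ball_bounded[OF assms] by blast
  have scale: "c * nrm Y (T u) \<le> B" if u: "u \<in> elems X" and c: "c \<ge> 0" "c * nrm X u \<le> 1" for c u
  proof -
    have TY: "T v \<in> elems Y" if "v \<in> elems X" for v
      using T(1) that by (auto simp: linear_op_def)
    have "nrm Y (T (c *\<^sub>R u) - c *\<^sub>R T u) = 0"
      using T(1) u by (auto simp: linear_op_def)
    then have "nrm Y (c *\<^sub>R T u) \<le> nrm Y (T (c *\<^sub>R u))"
      using Y.nrm_triangle_diff[of "c *\<^sub>R T u" "T (c *\<^sub>R u)"]
        Y.nrm_diff_commute[of "c *\<^sub>R T u" "T (c *\<^sub>R u)"] TY u by simp
    also have "\<dots> \<le> B"
      using c u by (intro B) (auto simp: X.nrm_scaleR)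
    finally show ?thesis using c u TY by (simp add: Y.nrm_scaleR)
  qed
  have "nrm Y (T u) \<le> B * nrm X u" if u: "u \<in> elems X" for u
  proof (cases "nrm X u = 0")
    case True
    \<comment> \<open>All multiples of \<open>u\<close> lie in the unit ball, so \<open>T u\<close> has norm 0.\<close>
    have "nrm Y (T u) \<le> 0"
    proof (rule ccontr)
      assume "\<not> nrm Y (T u) \<le> 0"
      then have "(\<bar>B\<bar> + 1) / nrm Y (T u) * nrm Y (T u) \<le> B"
        by (intro scale u) (auto simp: True)
      then show False using \<open>\<not> nrm Y (T u) \<le> 0\<close> by simp
    qed
    then show ?thesis by (simp add: True)
  next
    case False
    then have "nrm X u > 0" using X.nrm_nonneg[OF u] by simp
    then show ?thesis
      using scale[OF u, of "1 / nrm X u"] by (simp add: field_simps)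
  qed
  then show ?thesis using that by blast
qed

text \<open>
  Without a finite \<open>\<delta>\<close>-net one could choose points of the unit ball one after the other with images of
  mutual distance at least \<open>\<delta>\<close>; such a sequence of images has no convergent subsequence.
\<close>

lemma compact_op_totally_bounded:
  assumes "seminormed X" "seminormed Y" and T: "linear_op X Y T" "compact_op X Y T"
    and \<delta>: "\<delta> > 0"
  obtains F where "finite F" "F \<subseteq> elems Y"
    and "\<And>u. u \<in> elems X \<Longrightarrow> nrm X u \<le> 1 \<Longrightarrow> \<exists>y\<in>F. nrm Y (T u - y) < \<delta>"
proof -
  interpret Y: seminormed Y by fact
  have TY: "T u \<in> elems Y" if "u \<in> elems X" for u
    using T(1) that by (auto simp: linear_op_def)
  define U where "U = {u \<in> elems X. nrm X u \<le> 1}"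
  have "\<exists>K. finite K \<and> K \<subseteq> U \<and> (\<forall>u\<in>U. \<exists>v\<in>K. nrm Y (T u - T v) < \<delta>)"
  proof (rule ccontr)
    assume "\<not> ?thesis"
    then have no_net: "\<exists>u\<in>U. \<forall>v\<in>K. nrm Y (T u - T v) \<ge> \<delta>" if "finite K" "K \<subseteq> U" for K
      using that by (meson not_le)
    have "\<exists>s. \<forall>n::nat. s n \<in> U \<and> (\<forall>m<n. nrm Y (T (s n) - T (s m)) \<ge> \<delta>)"
    proof (rule dependent_wellorder_choice)
      fix n and s :: "nat \<Rightarrow> 'a"
      assume "\<And>m. m < n \<Longrightarrow> s m \<in> U \<and> (\<forall>k<m. nrm Y (T (s m) - T (s k)) \<ge> \<delta>)"
      then have "finite (s ` {..<n})" "s ` {..<n} \<subseteq> U" by auto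
      from no_net[OF this] show "\<exists>u. u \<in> U \<and> (\<forall>m<n. nrm Y (T u - T (s m)) \<ge> \<delta>)" by auto
    qed auto
    then obtain s :: "nat \<Rightarrow> 'a" where
      "\<forall>n. s n \<in> U \<and> (\<forall>m<n. nrm Y (T (s n) - T (s m)) \<ge> \<delta>)" ..
    then have s: "\<And>n. s n \<in> U" and sep: "\<And>m n. m < n \<Longrightarrow> nrm Y (T (s n) - T (s m)) \<ge> \<delta>"
      by simp_all
    have sX: "s n \<in> elems X" "nrm X (s n) \<le> 1" for n using s[of n] by (auto simp: U_def)
    then obtain r y where r: "strict_mono r" and y: "y \<in> elems Y"
      and lim: "(\<lambda>n. nrm Y (T (s (r n)) - y)) \<longlonglongrightarrow> 0"
      using T(2) unfolding compact_op_def by metis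
    from lim have "eventually (\<lambda>n. nrm Y (T (s (r n)) - y) < \<delta> / 2) sequentially"
      by (rule order_tendstoD) (use \<delta> in simp)
    then obtain N where N: "\<And>n. n \<ge> N \<Longrightarrow> nrm Y (T (s (r n)) - y) < \<delta> / 2"
      by (auto simp: eventually_sequentially)
    let ?a = "T (s (r (Suc N)))" and ?b = "T (s (r N))"
    have "nrm Y (?a - ?b) \<le> nrm Y (?a - y) + nrm Y (y - ?b)"
      using Y.nrm_triangle[of "?a - y" "y - ?b"] TY sX y by simp
    also have "\<dots> < \<delta>"
      using N[of "Suc N"] N[of N] Y.nrm_diff_commute[OF y TY[OF sX(1)[of "r N"]]] by simp
    finally show False
      using sep[of "r N" "r (Suc N)"] r by (simp add: strict_mono_def)
  qed
  then obtain K where "finite K" "K \<subseteq> U" "\<And>u. u \<in> U \<Longrightarrow> \<exists>v\<in>K. nrm Y (T u - T v) < \<delta>" by blast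
  then show ?thesis
    using TY by (intro that[of "T ` K"]) (auto simp: U_def)
qed

section \<open>The spaces of integrable and of essentially bounded functions\<close>

lemma seminormed_L1: "seminormed (L1 \<Omega>)"
proof
  show "subspace (elems (L1 \<Omega>))"
    by (rule subspaceI) (auto simp: L1_def plus_fun_def scaleR_fun_def zero_fun_def)
next
  fix u v :: "'a \<Rightarrow> real" assume "u \<in> elems (L1 \<Omega>)" "v \<in> elems (L1 \<Omega>)"
  then have uv: "integrable (lebesgue_on \<Omega>) u" "integrable (lebesgue_on \<Omega>) v"
    by (auto simp: L1_def)
  then have "(\<integral>x. \<bar>u x + v x\<bar> \<partial>lebesgue_on \<Omega>) \<le> (\<integral>x. \<bar>u x\<bar> + \<bar>v x\<bar> \<partial>lebesgue_on \<Omega>)"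
    by (intro integral_mono) auto
  then show "nrm (L1 \<Omega>) (u + v) \<le> nrm (L1 \<Omega>) u + nrm (L1 \<Omega>) v"
    using uv by (simp add: L1_def)
next
  fix u :: "'a \<Rightarrow> real" and c assume "u \<in> elems (L1 \<Omega>)"
  then show "nrm (L1 \<Omega>) (c *\<^sub>R u) = \<bar>c\<bar> * nrm (L1 \<Omega>) u"
    by (simp add: L1_def abs_mult)
qed

text \<open>
  Together with the three bounds after it this characterisation stands in for the essential supremum
  and hides its extended real values, such as \<open>- \<infinity>\<close> when \<open>\<Gamma>\<close> is a null set.
\<close>

lemma mem_Linf_iff:
  "g \<in> elems (Linf \<Gamma>) \<longleftrightarrow>
    g \<in> borel_measurable (lebesgue_on \<Gamma>) \<and> (\<exists>C. AE t in lebesgue_on \<Gamma>. \<bar>g t\<bar> \<le> C)"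
    (is "?l \<longleftrightarrow> ?m \<and> ?b")
proof (intro iffI conjI)
  assume ?l
  then show ?m by (simp add: Linf_def)
  let ?e = "esssup (lebesgue_on \<Gamma>) (\<lambda>t. ereal \<bar>g t\<bar>)"
  have le: "AE t in lebesgue_on \<Gamma>. ereal \<bar>g t\<bar> \<le> ?e" by (rule esssup_AE)
  have "?e < \<infinity>" using \<open>?l\<close> by (simp add: Linf_def)
  then obtain C where "?e \<le> ereal C"
    by (cases ?e) auto
  with le have "AE t in lebesgue_on \<Gamma>. \<bar>g t\<bar> \<le> C"
    by (auto elim!: eventually_mono dest: order_trans)
  then show ?b by blast
next
  assume *: "?m \<and> ?b"
  then obtain C where C: "AE t in lebesgue_on \<Gamma>. \<bar>g t\<bar> \<le> C" by blast
  have "esssup (lebesgue_on \<Gamma>) (\<lambda>t. ereal \<bar>g t\<bar>) \<le> ereal C"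
    using * C by (intro esssup_I) auto
  then have "esssup (lebesgue_on \<Gamma>) (\<lambda>t. ereal \<bar>g t\<bar>) < \<infinity>"
    using le_less_trans less_ereal.simps(4) by blast
  with * show ?l by (simp add: Linf_def)
qed

lemma Linf_measurable [measurable_dest]:
  "g \<in> elems (Linf \<Gamma>) \<Longrightarrow> g \<in> borel_measurable (lebesgue_on \<Gamma>)"
  by (simp add: mem_Linf_iff)

lemma Linf_AE_le:
  assumes "g \<in> elems (Linf \<Gamma>)"
  shows "AE t in lebesgue_on \<Gamma>. \<bar>g t\<bar> \<le> nrm (Linf \<Gamma>) g"
proof -
  let ?e = "esssup (lebesgue_on \<Gamma>) (\<lambda>t. ereal \<bar>g t\<bar>)"
  have le: "AE t in lebesgue_on \<Gamma>. ereal \<bar>g t\<bar> \<le> ?e" by (rule esssup_AE)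
  have "?e < \<infinity>" using assms by (simp add: Linf_def)
  then have "ereal x \<le> ?e \<Longrightarrow> x \<le> real_of_ereal ?e" for x
    by (cases ?e) auto
  with le show ?thesis
    by (auto simp: Linf_def elim!: eventually_mono)
qed

lemma Linf_nrm_le:
  assumes "g \<in> borel_measurable (lebesgue_on \<Gamma>)" "AE t in lebesgue_on \<Gamma>. \<bar>g t\<bar> \<le> C" "0 \<le> C"
  shows "nrm (Linf \<Gamma>) g \<le> C"
proof -
  have "esssup (lebesgue_on \<Gamma>) (\<lambda>t. ereal \<bar>g t\<bar>) \<le> ereal C"
    using assms by (intro esssup_I) auto
  then show ?thesis
    using assms(3) by (cases "esssup (lebesgue_on \<Gamma>) (\<lambda>t. ereal \<bar>g t\<bar>)") (auto simp: Linf_def)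
qed

lemma Linf_nrm_nonneg: 
  assumes "g \<in> elems (Linf \<Gamma>)"
  shows "0 \<le> nrm (Linf \<Gamma>) g"
proof (cases "AE t in lebesgue_on \<Gamma>. False")
  case True
  then have "esssup (lebesgue_on \<Gamma>) (\<lambda>t. ereal \<bar>g t\<bar>) \<le> -\<infinity>"
    using assms by (intro esssup_I) (auto simp: mem_Linf_iff)
  then show ?thesis by (simp add: Linf_def)
next
  case False
  show ?thesis
  proof (rule ccontr)
    assume neg: "\<not> ?thesis"
    from Linf_AE_le[OF assms] have "AE t in lebesgue_on \<Gamma>. False"
      by eventually_elim (use neg in linarith)
    with False show False by contradiction
  qed
qed

lemma Linf_scaleR:
  assumes g: "g \<in> elems (Linf \<Gamma>)"
  shows "c *\<^sub>R g \<in> elems (Linf \<Gamma>)"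
proof -
  from Linf_AE_le[OF g] have "AE t in lebesgue_on \<Gamma>. \<bar>c * g t\<bar> \<le> \<bar>c\<bar> * nrm (Linf \<Gamma>) g"
    by eventually_elim (simp add: abs_mult mult_left_mono)
  then show ?thesis
    using g by (auto simp: mem_Linf_iff scaleR_fun_def)
qed

lemma seminormed_Linf: "seminormed (Linf \<Gamma>)"
proof
  show "subspace (elems (Linf \<Gamma>))"
  proof (rule subspaceI)
    show "0 \<in> elems (Linf \<Gamma>)"
      by (auto simp: mem_Linf_iff zero_fun_def)
  next
    fix g h assume gh: "g \<in> elems (Linf \<Gamma>)" "h \<in> elems (Linf \<Gamma>)"
    from Linf_AE_le[OF gh(1)] Linf_AE_le[OF gh(2)]
    have "AE t in lebesgue_on \<Gamma>. \<bar>g t + h t\<bar> \<le> nrm (Linf \<Gamma>) g + nrm (Linf \<Gamma>) h"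
      by eventually_elim linarith
    then show "g + h \<in> elems (Linf \<Gamma>)"
      using gh by (auto simp: mem_Linf_iff plus_fun_def)
  next
    show "c *\<^sub>R g \<in> elems (Linf \<Gamma>)" if "g \<in> elems (Linf \<Gamma>)" for c g
      using that by (rule Linf_scaleR)
  qed
next
  fix g h assume gh: "g \<in> elems (Linf \<Gamma>)" "h \<in> elems (Linf \<Gamma>)"
  from Linf_AE_le[OF gh(1)] Linf_AE_le[OF gh(2)]
  have "AE t in lebesgue_on \<Gamma>. \<bar>(g + h) t\<bar> \<le> nrm (Linf \<Gamma>) g + nrm (Linf \<Gamma>) h"
    by eventually_elim simp
  then show "nrm (Linf \<Gamma>) (g + h) \<le> nrm (Linf \<Gamma>) g + nrm (Linf \<Gamma>) h"
    using gh Linf_nrm_nonneg[OF gh(1)] Linf_nrm_nonneg[OF gh(2)]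
    by (intro Linf_nrm_le) (auto simp: mem_Linf_iff plus_fun_def)
next
  have le: "nrm (Linf \<Gamma>) (c *\<^sub>R g) \<le> \<bar>c\<bar> * nrm (Linf \<Gamma>) g" if g: "g \<in> elems (Linf \<Gamma>)" for c g
  proof (rule Linf_nrm_le)
    show "AE t in lebesgue_on \<Gamma>. \<bar>(c *\<^sub>R g) t\<bar> \<le> \<bar>c\<bar> * nrm (Linf \<Gamma>) g"
      using Linf_AE_le[OF g] by eventually_elim (simp add: abs_mult mult_left_mono)
  qed (use g Linf_nrm_nonneg[OF g] in \<open>auto simp: mem_Linf_iff scaleR_fun_def\<close>)
  fix c g assume g: "g \<in> elems (Linf \<Gamma>)"
  then have cg: "c *\<^sub>R g \<in> elems (Linf \<Gamma>)"
    by (rule Linf_scaleR)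
  show "nrm (Linf \<Gamma>) (c *\<^sub>R g) = \<bar>c\<bar> * nrm (Linf \<Gamma>) g"
  proof (cases "c = 0")
    case True
    then show ?thesis
      using le[OF g, of c] Linf_nrm_nonneg[OF cg] by simp
  next
    case False
    with le[OF cg, of "1 / c"] le[OF g, of c] show ?thesis
      by (simp add: field_simps)
  qed
qed

section \<open>Approximation of functionals on bounded functions by bounded densities\<close>

lemma sum_fun_apply: "(\<Sum>i\<in>I. g i) x = (\<Sum>i\<in>I. g i x)"
  by (induction I rule: infinite_finite_induct) auto

text \<open>
  All functions in \<open>F\<close> are to be approximated by functions of one and the same step function \<open>G\<close>.
  Its values are the lists of the rounded values of the members of \<open>F\<close>, so each member is recovered
  up to \<open>\<delta>\<close> from one entry of the list.
\<close>

lemma simultaneous_step_approximation: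
  fixes F :: "('a \<Rightarrow> real) set"
  assumes "finite F" and "\<And>y. y \<in> F \<Longrightarrow> y \<in> borel_measurable M"
    and "\<And>y. y \<in> F \<Longrightarrow> \<exists>B. AE t in M. \<bar>y t\<bar> \<le> B" and \<delta>: "\<delta> > 0"
  shows "\<exists>G :: 'a \<Rightarrow> int list. simple_function M G \<and> (\<forall>y\<in>F. \<exists>\<phi>. AE t in M. \<bar>y t - \<phi> (G t)\<bar> \<le> \<delta>)"
  using assms(1-3)
proof (induction F rule: finite_induct)
  case empty
  show ?case by (intro exI[of _ "\<lambda>_. []"]) auto
next
  case (insert y F)
  then have "\<exists>G :: 'a \<Rightarrow> int list. simple_function M G \<and> (\<forall>y\<in>F. \<exists>\<phi>. AE t in M. \<bar>y t - \<phi> (G t)\<bar> \<le> \<delta>)"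
    by simp
  then obtain G :: "'a \<Rightarrow> int list" where G: "simple_function M G"
    and F: "\<forall>y\<in>F. \<exists>\<phi>. AE t in M. \<bar>y t - \<phi> (G t)\<bar> \<le> \<delta>" by blast
  obtain B where B: "AE t in M. \<bar>y t\<bar> \<le> B" using insert.prems(2)[of y] by auto
  have y [measurable]: "y \<in> borel_measurable M" using insert.prems(1)[of y] by simp
  \<comment> \<open>Truncation at \<open>B\<close> changes \<open>y\<close> on a null set only and makes the rounded function finite-valued everywhere.\<close>
  define clip where "clip t = max (- B) (min B (y t)) / \<delta>" for t
  have clip [measurable]: "clip \<in> borel_measurable M" unfolding clip_def by measurable
  have bound: "- (\<bar>B\<bar> / \<delta>) \<le> clip t" "clip t \<le> \<bar>B\<bar> / \<delta>" for t
    using \<delta> by (auto simp: clip_def divide_simps)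
  have "simple_function M (\<lambda>t. \<lfloor>clip t\<rfloor>)"
    unfolding simple_function_def
  proof (intro conjI ballI)
    have "(\<lambda>t. \<lfloor>clip t\<rfloor>) ` space M \<subseteq> {\<lfloor>- (\<bar>B\<bar> / \<delta>)\<rfloor>..\<lfloor>\<bar>B\<bar> / \<delta>\<rfloor>}"
      using floor_mono[OF bound(1)] floor_mono[OF bound(2)] by auto
    then show "finite ((\<lambda>t. \<lfloor>clip t\<rfloor>) ` space M)" by (rule finite_subset) simp
  next
    fix k
    have "{t \<in> space M. \<lfloor>clip t\<rfloor> = k} \<in> sets M" by measurable
    then show "(\<lambda>t. \<lfloor>clip t\<rfloor>) -` {k} \<inter> space M \<in> sets M"
      by (simp add: vimage_def Int_def conj_commute)
  qed
  then have G': "simple_function M (\<lambda>t. \<lfloor>clip t\<rfloor> # G t)"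
    using G by (rule simple_function_compose2)
  have "AE t in M. \<bar>y t - \<delta> * real_of_int (hd (\<lfloor>clip t\<rfloor> # G t))\<bar> \<le> \<delta>"
    using B
  proof eventually_elim
    case (elim t)
    then have "y t = \<delta> * clip t" using \<delta> by (auto simp: clip_def)
    then have "y t - \<delta> * real_of_int \<lfloor>clip t\<rfloor> = \<delta> * frac (clip t)"
      by (simp add: frac_def algebra_simps)
    then show ?case
      using \<delta> frac_lt_1[of "clip t"] by (simp add: abs_mult frac_ge_0 mult_left_le)
  qed
  moreover have "\<exists>\<phi>. AE t in M. \<bar>z t - \<phi> (\<lfloor>clip t\<rfloor> # G t)\<bar> \<le> \<delta>" if z: "z \<in> F" for z
  proof -
    obtain \<phi> where "AE t in M. \<bar>z t - \<phi> (G t)\<bar> \<le> \<delta>" using F z by blast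
    then show ?thesis by (intro exI[of _ "\<phi> \<circ> tl"]) simp
  qed
  ultimately have "\<forall>z\<in>insert y F. \<exists>\<phi>. AE t in M. \<bar>z t - \<phi> (\<lfloor>clip t\<rfloor> # G t)\<bar> \<le> \<delta>"
    by (auto intro!: exI[of _ "\<lambda>l. \<delta> * real_of_int (hd l)"])
  with G' show ?case by blast
qed

lemma step_function_mem_Linf:
  fixes c :: "'b \<Rightarrow> real"
  assumes G: "simple_function (lebesgue_on \<Gamma>) G"
  shows "(\<lambda>t. c (G t)) \<in> elems (Linf \<Gamma>)"
  unfolding mem_Linf_iff
proof (intro conjI exI)
  show "(\<lambda>t. c (G t)) \<in> borel_measurable (lebesgue_on \<Gamma>)"
    by (rule borel_measurable_simple_function[OF simple_function_compose1[OF G]])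
  have "finite (G ` space (lebesgue_on \<Gamma>))" using G by (rule simple_functionD)
  then show "AE t in lebesgue_on \<Gamma>. \<bar>c (G t)\<bar> \<le> (\<Sum>l\<in>G ` space (lebesgue_on \<Gamma>). \<bar>c l\<bar>)"
    by (intro AE_I2 member_le_sum) auto
qed

lemma dual_Linf_AE_cong:
  assumes \<psi>: "\<psi> \<in> elems (dual (Linf \<Gamma>))" and gh: "g \<in> elems (Linf \<Gamma>)" "h \<in> elems (Linf \<Gamma>)"
    and AE: "AE t in lebesgue_on \<Gamma>. g t = h t"
  shows "\<psi> g = \<psi> h"
proof -
  interpret L: seminormed "Linf \<Gamma>" by (rule seminormed_Linf)
  have "AE t in lebesgue_on \<Gamma>. \<bar>(g - h) t\<bar> \<le> 0" using AE by eventually_elim simp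
  moreover have "g - h \<in> borel_measurable (lebesgue_on \<Gamma>)"
    using L.diff_mem[OF gh] by (simp add: mem_Linf_iff)
  ultimately have "nrm (Linf \<Gamma>) (g - h) \<le> 0" by (intro Linf_nrm_le) auto
  then have "nrm (Linf \<Gamma>) (g - h) = 0" using L.nrm_nonneg[OF L.diff_mem[OF gh]] by simp
  then show ?thesis by (rule L.dual_cong[OF \<psi> gh])
qed

lemma Linf_mult:
  assumes g: "g \<in> elems (Linf \<Gamma>)" and h: "h \<in> elems (Linf \<Gamma>)"
  shows "(\<lambda>t. g t * h t) \<in> elems (Linf \<Gamma>)"
proof -
  from Linf_AE_le[OF g] Linf_AE_le[OF h]
  have "AE t in lebesgue_on \<Gamma>. \<bar>g t * h t\<bar> \<le> nrm (Linf \<Gamma>) g * nrm (Linf \<Gamma>) h"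
    by eventually_elim (simp add: abs_mult mult_mono Linf_nrm_nonneg[OF g])
  then show ?thesis
    using g h by (auto simp: mem_Linf_iff)
qed

lemma Linf_integrable:
  assumes \<Gamma>: "\<Gamma> \<in> lmeasurable" and g: "g \<in> elems (Linf \<Gamma>)"
  shows "integrable (lebesgue_on \<Gamma>) g"
proof -
  interpret finite_measure "lebesgue_on \<Gamma>" using \<Gamma> by (rule finite_measure_lebesgue_on)
  show ?thesis
    using g Linf_AE_le[OF g] by (intro integrable_const_bound[where B="nrm (Linf \<Gamma>) g"]) (auto simp: mem_Linf_iff)
qed

text \<open>
  On the finite-dimensional space of functions of \<open>G\<close>, a functional is integration against the step
  function with value \<open>\<psi> (indicator E) / measure E\<close> on each level set \<open>E\<close> of \<open>G\<close>.  On level sets of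
  measure 0 the quotient is 0, as it has to be, because \<open>\<psi>\<close> vanishes on functions that are zero
  almost everywhere.
\<close>

lemma dual_Linf_step_density:
  fixes G :: "'a::euclidean_space \<Rightarrow> 'b"
  assumes \<Gamma>: "\<Gamma> \<in> lmeasurable" and \<psi>: "\<psi> \<in> elems (dual (Linf \<Gamma>))"
    and G: "simple_function (lebesgue_on \<Gamma>) G"
  obtains c :: "'b \<Rightarrow> real" where "\<And>\<phi>. (\<integral>t. c (G t) * \<phi> (G t) \<partial>lebesgue_on \<Gamma>) = \<psi> (\<lambda>t. \<phi> (G t))"
proof -
  interpret L: seminormed "Linf \<Gamma>" by (rule seminormed_Linf)
  let ?M = "lebesgue_on \<Gamma>"
  interpret finite_measure ?M using \<Gamma> by (rule finite_measure_lebesgue_on)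
  define E where "E l = G -` {l} \<inter> space ?M" for l
  define I where "I l = (indicat_real (E l))" for l
  have E [measurable]: "E l \<in> sets ?M" for l unfolding E_def using G by (rule simple_functionD)
  have fin: "finite (G ` space ?M)" using G by (rule simple_functionD)
  have I: "I l \<in> elems (Linf \<Gamma>)" for l
    unfolding I_def mem_Linf_iff by (auto intro!: exI[of _ 1] simp: indicator_def)
  have int_I: "integrable ?M (I l)" for l using \<Gamma> I by (rule Linf_integrable)
  have integral_I: "(\<integral>t. I l t \<partial>?M) = measure ?M (E l)" for l
  proof -
    have "E l \<inter> space ?M = E l" by (auto simp: E_def)
    then show ?thesis by (simp only: I_def Bochner_Integration.integral_indicator)
  qed
  define c where "c l = \<psi> (I l) / measure ?M (E l)" for l
  have c: "c l * measure ?M (E l) = \<psi> (I l)" for l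
  proof (cases "measure ?M (E l) = 0")
    case True
    then have "E l \<in> null_sets ?M" by (auto simp: null_sets_def emeasure_eq_measure)
    then have "AE t in ?M. t \<notin> E l" by (rule AE_not_in)
    then have "AE t in ?M. I l t = 0 t"
      by eventually_elim (simp add: I_def)
    then have "\<psi> (I l) = \<psi> 0" by (intro dual_Linf_AE_cong[OF \<psi>] I) auto
    then show ?thesis using True by (simp add: L.dual_zero[OF \<psi>])
  qed (simp add: c_def)
  have expand: "(\<Sum>l\<in>G ` space ?M. d l * I l t) = d (G t)" if "t \<in> space ?M" for d t
  proof -
    have "(\<Sum>l\<in>G ` space ?M. d l * I l t) = (\<Sum>l\<in>G ` space ?M. if l = G t then d l else 0)"
      using that by (intro sum.cong) (auto simp: I_def E_def)
    also have "\<dots> = d (G t)" using fin that by simp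
    finally show ?thesis .
  qed
  have "(\<integral>t. c (G t) * \<phi> (G t) \<partial>?M) = \<psi> (\<lambda>t. \<phi> (G t))" for \<phi>
  proof -
    have "(\<integral>t. c (G t) * \<phi> (G t) \<partial>?M) = (\<integral>t. (\<Sum>l\<in>G ` space ?M. (c l * \<phi> l) * I l t) \<partial>?M)"
      by (intro Bochner_Integration.integral_cong refl) (simp only: expand)
    also have "\<dots> = (\<Sum>l\<in>G ` space ?M. (c l * \<phi> l) * measure ?M (E l))"
      by (subst Bochner_Integration.integral_sum) (auto intro!: int_I simp: integral_I)
    also have "\<dots> = (\<Sum>l\<in>G ` space ?M. \<psi> (\<phi> l *\<^sub>R I l))"
      using I by (intro sum.cong) (auto simp: dual_scaleR[OF \<psi>] c[symmetric])
    also have "\<dots> = \<psi> (\<Sum>l\<in>G ` space ?M. \<phi> l *\<^sub>R I l)"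
      by (rule L.dual_sum[OF \<psi> L.scaleR_mem[OF I], symmetric])
    also have "\<dots> = \<psi> (\<lambda>t. \<phi> (G t))"
    proof (rule dual_Linf_AE_cong[OF \<psi>])
      show "(\<Sum>l\<in>G ` space ?M. \<phi> l *\<^sub>R I l) \<in> elems (Linf \<Gamma>)"
        by (intro subspace_sum[OF L.subspace_elems] L.scaleR_mem I)
      show "AE t in ?M. (\<Sum>l\<in>G ` space ?M. \<phi> l *\<^sub>R I l) t = \<phi> (G t)"
        by (intro AE_I2) (simp only: sum_fun_apply scaleR_fun_apply real_scaleR_def expand)
    qed (rule step_function_mem_Linf[OF G])
    finally show ?thesis .
  qed
  then show ?thesis by (rule that)
qed

lemma Linf_pairing_le:
  assumes \<Gamma>: "\<Gamma> \<in> lmeasurable" and p: "p \<in> elems (Linf \<Gamma>)" and z: "z \<in> elems (Linf \<Gamma>)"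
  shows "\<bar>\<integral>t. p t * z t \<partial>lebesgue_on \<Gamma>\<bar> \<le> (\<integral>t. \<bar>p t\<bar> \<partial>lebesgue_on \<Gamma>) * nrm (Linf \<Gamma>) z"
proof -
  have "\<bar>\<integral>t. p t * z t \<partial>lebesgue_on \<Gamma>\<bar> \<le> (\<integral>t. \<bar>p t * z t\<bar> \<partial>lebesgue_on \<Gamma>)"
    by (rule integral_abs_bound)
  also have "\<dots> \<le> (\<integral>t. \<bar>p t\<bar> * nrm (Linf \<Gamma>) z \<partial>lebesgue_on \<Gamma>)"
  proof (rule integral_mono_AE)
    show "AE t in lebesgue_on \<Gamma>. \<bar>p t * z t\<bar> \<le> \<bar>p t\<bar> * nrm (Linf \<Gamma>) z"
      using Linf_AE_le[OF z] by eventually_elim (simp add: abs_mult mult_left_mono)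
  qed (use Linf_integrable[OF \<Gamma> p] Linf_integrable[OF \<Gamma> Linf_mult[OF p z]] in auto)
  finally show ?thesis by simp
qed

text \<open>
  A quantitative form of Goldstine's theorem for \<open>L\<^sup>1\<close>: the ball of \<open>L\<^sup>1\<close> is weak-* dense in the ball of
  its bidual, the dual of \<open>L\<^sup>\<infinity>\<close>.  The density \<open>p\<close> that represents \<open>\<psi>\<close> on a space of step
  functions close to \<open>F\<close> serves the purpose; it is itself a step function, hence bounded.
\<close>

lemma dual_Linf_approx_by_density:
  assumes \<Gamma>: "\<Gamma> \<in> lmeasurable" and \<psi>: "\<psi> \<in> elems (dual (Linf \<Gamma>))"
    and F: "finite F" "F \<subseteq> elems (Linf \<Gamma>)" and \<delta>: "\<delta> > 0"
  obtains p where "p \<in> elems (Linf \<Gamma>)"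
    and "\<And>z. z \<in> elems (Linf \<Gamma>) \<Longrightarrow>
      \<bar>\<integral>t. p t * z t \<partial>lebesgue_on \<Gamma>\<bar> \<le> nrm (dual (Linf \<Gamma>)) \<psi> * nrm (Linf \<Gamma>) z"
    and "\<And>y. y \<in> F \<Longrightarrow> \<bar>(\<integral>t. p t * y t \<partial>lebesgue_on \<Gamma>) - \<psi> y\<bar> \<le> \<delta>"
proof -
  interpret L: seminormed "Linf \<Gamma>" by (rule seminormed_Linf)
  let ?M = "lebesgue_on \<Gamma>" and ?N = "nrm (dual (Linf \<Gamma>)) \<psi>"
  have N: "?N \<ge> 0" by (rule L.nrm_dual_nonneg[OF \<psi>])
  define \<epsilon> where "\<epsilon> = \<delta> / (2 * ?N + 1)"
  have \<epsilon>: "\<epsilon> > 0" "2 * ?N * \<epsilon> \<le> \<delta>" using \<delta> N by (auto simp: \<epsilon>_def field_simps)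
  have "y \<in> borel_measurable ?M" "\<exists>B. AE t in ?M. \<bar>y t\<bar> \<le> B" if "y \<in> F" for y
    using F(2) that by (auto simp: mem_Linf_iff)
  from simultaneous_step_approximation[OF F(1) this \<epsilon>(1)]
  obtain G :: "'a \<Rightarrow> int list" where
    "simple_function ?M G \<and> (\<forall>y\<in>F. \<exists>\<phi>. AE t in ?M. \<bar>y t - \<phi> (G t)\<bar> \<le> \<epsilon>)" ..
  then have G: "simple_function ?M G"
    and approx: "\<forall>y\<in>F. \<exists>\<phi>. AE t in ?M. \<bar>y t - \<phi> (G t)\<bar> \<le> \<epsilon>" by simp_all
  obtain c where c: "\<And>\<phi>. (\<integral>t. c (G t) * \<phi> (G t) \<partial>?M) = \<psi> (\<lambda>t. \<phi> (G t))"
    using dual_Linf_step_density[OF \<Gamma> \<psi> G] by blast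
  define p where "p t = c (G t)" for t
  have p: "p \<in> elems (Linf \<Gamma>)" unfolding p_def by (rule step_function_mem_Linf[OF G])
  \<comment> \<open>The sign of \<open>p\<close> is itself a step function, so the norm of \<open>p\<close> in \<open>L\<^sup>1\<close> is a value of \<open>\<psi>\<close>.\<close>
  have p1: "(\<integral>t. \<bar>p t\<bar> \<partial>?M) \<le> ?N"
  proof -
    have "(\<integral>t. \<bar>p t\<bar> \<partial>?M) = \<psi> (\<lambda>t. sgn (c (G t)))"
      using c[of "\<lambda>l. sgn (c l)"] by (simp add: p_def abs_sgn)
    also have "\<dots> \<le> ?N"
    proof -
      have "nrm (Linf \<Gamma>) (\<lambda>t. sgn (c (G t))) \<le> 1"
        using step_function_mem_Linf[OF G, of "\<lambda>l. sgn (c l)"]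
        by (intro Linf_nrm_le) (auto simp: mem_Linf_iff abs_sgn_eq)
      from L.dual_le_unit_ball[OF \<psi> step_function_mem_Linf[OF G, of "\<lambda>l. sgn (c l)"] this]
      show ?thesis by simp
    qed
    finally show ?thesis .
  qed
  have le: "\<bar>\<integral>t. p t * z t \<partial>?M\<bar> \<le> ?N * nrm (Linf \<Gamma>) z" if z: "z \<in> elems (Linf \<Gamma>)" for z
    using Linf_pairing_le[OF \<Gamma> p z] mult_right_mono[OF p1 L.nrm_nonneg[OF z]] by linarith
  have "\<bar>(\<integral>t. p t * y t \<partial>?M) - \<psi> y\<bar> \<le> \<delta>" if y: "y \<in> F" for y
  proof -
    obtain \<phi> where \<phi>: "AE t in ?M. \<bar>y t - \<phi> (G t)\<bar> \<le> \<epsilon>" using approx y by blast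
    define z where "z = (\<lambda>t. \<phi> (G t))"
    have z: "z \<in> elems (Linf \<Gamma>)" unfolding z_def by (rule step_function_mem_Linf[OF G])
    have yL: "y \<in> elems (Linf \<Gamma>)" using F y by blast
    have small: "nrm (Linf \<Gamma>) (y - z) \<le> \<epsilon>"
      using L.diff_mem[OF yL z] \<phi> \<epsilon> by (intro Linf_nrm_le) (auto simp: mem_Linf_iff z_def)
    have "(\<integral>t. p t * y t \<partial>?M) - \<psi> y
      = (\<integral>t. p t * y t \<partial>?M) - (\<integral>t. p t * z t \<partial>?M) - (\<psi> y - \<psi> z)"
      using c[of \<phi>] by (simp add: p_def z_def)
    also have "\<dots> = (\<integral>t. p t * (y - z) t \<partial>?M) - \<psi> (y - z)"
      using Linf_integrable[OF \<Gamma> Linf_mult[OF p yL]] Linf_integrable[OF \<Gamma> Linf_mult[OF p z]]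
      by (simp add: L.dual_diff[OF \<psi> yL z] right_diff_distrib)
    finally have "\<bar>(\<integral>t. p t * y t \<partial>?M) - \<psi> y\<bar> \<le> 2 * (?N * nrm (Linf \<Gamma>) (y - z))"
      using le[OF L.diff_mem[OF yL z]] L.dual_le[OF \<psi> L.diff_mem[OF yL z]] by linarith
    also have "\<dots> \<le> 2 * (?N * \<epsilon>)" using small N by (simp add: mult_left_mono)
    finally show ?thesis using \<epsilon> by linarith
  qed
  with p le show ?thesis by (rule that)
qed

section \<open>Second-order expansion at a point with a subgradient\<close>

lemma frechet_derivative_along_line:
  assumes "seminormed X" and D: "D \<in> elems (dual X)" "has_frechet_derivative X real_space g D y"
    and h: "h \<in> elems X"
  shows "((\<lambda>s. g (y + s *\<^sub>R h)) has_real_derivative D h) (at 0)"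
  unfolding DERIV_def
proof (rule tendstoI)
  interpret seminormed X by fact
  fix e :: real assume e: "e > 0"
  have a: "nrm X h \<ge> 0" by (rule nrm_nonneg[OF h])
  define \<epsilon> where "\<epsilon> = e / (nrm X h + 1)"
  have \<epsilon>: "\<epsilon> > 0" "\<epsilon> * nrm X h < e" using e a by (auto simp: \<epsilon>_def field_simps)
  obtain \<delta> where \<delta>: "\<delta> > 0"
    and small: "\<And>k. k \<in> elems X \<Longrightarrow> nrm X k < \<delta> \<Longrightarrow> \<bar>g (y + k) - g y - D k\<bar> \<le> \<epsilon> * nrm X k"
    using D(2) \<epsilon> unfolding has_frechet_derivative_def real_space_def by auto
  show "eventually (\<lambda>s. dist ((g (y + (0 + s) *\<^sub>R h) - g (y + 0 *\<^sub>R h)) / s) (D h) < e) (at 0)"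
    unfolding eventually_at
  proof (intro exI[of _ "\<delta> / (nrm X h + 1)"] conjI ballI impI)
    show "\<delta> / (nrm X h + 1) > 0" using \<delta> a by simp
    fix s :: real assume "s \<noteq> 0 \<and> dist s 0 < \<delta> / (nrm X h + 1)"
    then have s: "s \<noteq> 0" "\<bar>s\<bar> * (nrm X h + 1) < \<delta>" using a by (auto simp: pos_less_divide_eq)
    then have "\<bar>s\<bar> * nrm X h < \<delta>" by (simp add: distrib_left)
    then have "\<bar>g (y + s *\<^sub>R h) - g y - D (s *\<^sub>R h)\<bar> \<le> \<epsilon> * nrm X (s *\<^sub>R h)"
      using h by (intro small) (auto simp: nrm_scaleR)
    then have "\<bar>g (y + s *\<^sub>R h) - g y - s * D h\<bar> \<le> \<bar>s\<bar> * (\<epsilon> * nrm X h)"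
      using h by (simp add: nrm_scaleR dual_scaleR[OF D(1)] mult.left_commute)
    also have "\<dots> < \<bar>s\<bar> * e" using s \<epsilon> by (intro mult_strict_left_mono) auto
    finally have "\<bar>g (y + s *\<^sub>R h) - g y - s * D h\<bar> < \<bar>s\<bar> * e" .
    moreover have "g (y + s *\<^sub>R h) - g y - s * D h = s * ((g (y + s *\<^sub>R h) - g y) / s - D h)"
      using s by (simp add: field_simps)
    ultimately have "\<bar>s * ((g (y + s *\<^sub>R h) - g y) / s - D h)\<bar> < \<bar>s\<bar> * e" by simp
    then show "dist ((g (y + (0 + s) *\<^sub>R h) - g (y + 0 *\<^sub>R h)) / s) (D h) < e"
      using s by (simp add: abs_mult dist_real_def)
  qed
qed

text \<open>
  The remainder \<open>F (x + h) - F x - l h\<close> vanishes to first order at \<open>x\<close>.  Its derivative at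
  \<open>x + h\<close> is \<open>D (x + h) - D x\<close>, which is of order \<open>\<parallel>h\<parallel>\<close> because the derivative of \<open>F\<close> is
  differentiable at \<open>x\<close>; the mean value theorem on the segment then gives the square.
\<close>

lemma quadratic_bound_at_subgradient:
  assumes "seminormed X" and x: "x \<in> elems X" and F: "twice_frechet_differentiable X F x"
    and l: "l \<in> elems (dual X)" and sub: "\<And>h. h \<in> elems X \<Longrightarrow> F x + ereal (l h) \<le> F (x + h)"
  obtains K r where "r > 0" "K \<ge> 0"
    and "\<And>h. h \<in> elems X \<Longrightarrow> nrm X h < r \<Longrightarrow> \<bar>F (x + h)\<bar> \<noteq> \<infinity> \<and>
      real_of_ereal (F (x + h)) - real_of_ereal (F x) - l h \<le> K * (nrm X h)\<^sup>2"
proof -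
  interpret seminormed X by fact
  interpret D: seminormed "dual X" by (rule seminormed_dual)
  define g where "g = (\<lambda>z. real_of_ereal (F z))"
  obtain r D T where r: "r > 0"
    and near: "\<And>y. y \<in> elems X \<Longrightarrow> nrm X (y - x) < r \<Longrightarrow>
      \<bar>F y\<bar> \<noteq> \<infinity> \<and> D y \<in> elems (dual X) \<and> has_frechet_derivative X real_space g (D y) y"
    and T: "has_frechet_derivative X (dual X) D T x"
    using F unfolding twice_frechet_differentiable_def g_def[symmetric] by metis
  have fin: "\<bar>F (x + h)\<bar> \<noteq> \<infinity>" and D: "D (x + h) \<in> elems (dual X)"
    and dF: "has_frechet_derivative X real_space g (D (x + h)) (x + h)"
    if "h \<in> elems X" "nrm X h < r" for h
    using near[of "x + h"] x that by auto
  have D0: "D x \<in> elems (dual X)" using D[of 0] r by simp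
  have deriv: "((\<lambda>s. g (x + s *\<^sub>R h) - g x - s * l h) has_real_derivative D (x + t *\<^sub>R h) h - l h) (at t)"
    if h: "h \<in> elems X" and t: "nrm X (t *\<^sub>R h) < r" for h t
  proof -
    have th: "t *\<^sub>R h \<in> elems X" using h by simp
    have "((\<lambda>s. g (x + t *\<^sub>R h + s *\<^sub>R h)) has_real_derivative D (x + t *\<^sub>R h) h) (at 0)"
      by (rule frechet_derivative_along_line[OF assms(1) D[OF th t] dF[OF th t] h])
    then have "((\<lambda>s. g (x + (s + t) *\<^sub>R h)) has_real_derivative D (x + t *\<^sub>R h) h) (at 0)"
      by (simp add: scaleR_add_left add_ac)
    then have "((\<lambda>s. g (x + s *\<^sub>R h)) has_real_derivative D (x + t *\<^sub>R h) h) (at t)"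
      using DERIV_shift[of "\<lambda>s. g (x + s *\<^sub>R h)" _ 0 t] by simp
    then show ?thesis by (auto intro!: derivative_eq_intros)
  qed
  \<comment> \<open>The remainder has a minimum at \<open>x\<close>, so the derivative of \<open>F\<close> there is the subgradient.\<close>
  have Dl: "D x h = l h" if h: "h \<in> elems X" for h
  proof -
    have a: "nrm X h \<ge> 0" by (rule nrm_nonneg[OF h])
    have "D (x + 0 *\<^sub>R h) h - l h = 0"
    proof (rule DERIV_local_min[OF deriv[OF h]])
      show "nrm X (0 *\<^sub>R h) < r" using r by simp
      show "0 < r / (nrm X h + 1)" using r a by simp
      show "\<forall>s. \<bar>0 - s\<bar> < r / (nrm X h + 1) \<longrightarrow>
        g (x + 0 *\<^sub>R h) - g x - 0 * l h \<le> g (x + s *\<^sub>R h) - g x - s * l h"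
      proof (intro allI impI)
        fix s :: real assume "\<bar>0 - s\<bar> < r / (nrm X h + 1)"
        then have "\<bar>s\<bar> * (nrm X h + 1) < r" using a by (auto simp: pos_less_divide_eq)
        then have "nrm X (s *\<^sub>R h) < r" using h by (simp add: nrm_scaleR distrib_left)
        then have "\<bar>F (x + s *\<^sub>R h)\<bar> \<noteq> \<infinity>" "\<bar>F x\<bar> \<noteq> \<infinity>"
          using fin[of "s *\<^sub>R h"] fin[of 0] h r by auto
        moreover have "F x + ereal (s * l h) \<le> F (x + s *\<^sub>R h)"
          using sub[of "s *\<^sub>R h"] h by (simp add: dual_scaleR[OF l])
        ultimately have "g x + s * l h \<le> g (x + s *\<^sub>R h)"
          by (cases "F x"; cases "F (x + s *\<^sub>R h)") (auto simp: g_def)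
        then show "g (x + 0 *\<^sub>R h) - g x - 0 * l h \<le> g (x + s *\<^sub>R h) - g x - s * l h" by simp
      qed
    qed
    then show ?thesis by simp
  qed
  obtain C where C: "\<And>h. h \<in> elems X \<Longrightarrow> nrm (dual X) (T h) \<le> C * nrm X h"
    using T unfolding has_frechet_derivative_def bounded_linear_op_def by blast
  have TX: "T h \<in> elems (dual X)" if "h \<in> elems X" for h
    using T that unfolding has_frechet_derivative_def bounded_linear_op_def linear_op_def by blast
  obtain \<delta> where \<delta>: "\<delta> > 0"
    and small: "\<And>h. h \<in> elems X \<Longrightarrow> nrm X h < \<delta> \<Longrightarrow> nrm (dual X) (D (x + h) - D x - T h) \<le> 1 * nrm X h"
    using T zero_less_one unfolding has_frechet_derivative_def by blast
  define K where "K = \<bar>C\<bar> + 1"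
  have lip: "nrm (dual X) (D (x + h) - D x) \<le> K * nrm X h"
    if h: "h \<in> elems X" "nrm X h < \<delta>" "nrm X h < r" for h
  proof -
    have "nrm (dual X) (D (x + h) - D x) \<le> nrm (dual X) (D (x + h) - D x - T h) + nrm (dual X) (T h)"
      using D[OF h(1,3)] D0 TX[OF h(1)] by (intro D.nrm_triangle_diff D.diff_mem)
    also have "\<dots> \<le> 1 * nrm X h + C * nrm X h" using small[OF h(1,2)] C[OF h(1)] by linarith
    also have "\<dots> \<le> K * nrm X h"
      using mult_right_mono[OF abs_ge_self[of C] nrm_nonneg[OF h(1)]] by (simp add: K_def algebra_simps)
    finally show ?thesis .
  qed
  have bound: "g (x + h) - g x - l h \<le> K * (nrm X h)\<^sup>2"
    if h: "h \<in> elems X" "nrm X h < min r \<delta>" for h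
  proof -
    have a: "nrm X h \<ge> 0" by (rule nrm_nonneg[OF h(1)])
    have le: "nrm X (t *\<^sub>R h) \<le> nrm X h" if "0 \<le> t" "t \<le> 1" for t
      using that a h by (simp add: nrm_scaleR mult_left_le_one_le)
    have "\<exists>z>0. z < 1 \<and>
      (g (x + 1 *\<^sub>R h) - g x - 1 * l h) - (g (x + 0 *\<^sub>R h) - g x - 0 * l h)
        = (1 - 0) * (D (x + z *\<^sub>R h) h - l h)"
      by (rule MVT2) (use le h in \<open>force intro!: deriv\<close>)+
    then obtain z where z: "0 < z" "z < 1" and eq: "g (x + h) - g x - l h = D (x + z *\<^sub>R h) h - l h"
      by auto
    have zh: "z *\<^sub>R h \<in> elems X" "nrm X (z *\<^sub>R h) < \<delta>" "nrm X (z *\<^sub>R h) < r"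
      using h le[of z] z by auto
    have "g (x + h) - g x - l h = (D (x + z *\<^sub>R h) - D x) h" using Dl[OF h(1)] by (simp add: eq)
    also have "\<dots> \<le> nrm (dual X) (D (x + z *\<^sub>R h) - D x) * nrm X h"
      using dual_le[OF D.diff_mem[OF D[OF zh(1,3)] D0] h(1)] by linarith
    also have "\<dots> \<le> (K * nrm X (z *\<^sub>R h)) * nrm X h"
      by (intro mult_right_mono lip zh a)
    also have "\<dots> \<le> (K * nrm X h) * nrm X h"
      using z le[of z] a by (intro mult_right_mono mult_left_mono) (auto simp: K_def)
    finally show ?thesis by (simp add: power2_eq_square mult.assoc)
  qed
  show ?thesis
  proof (rule that[of "min r \<delta>" K])
    show "min r \<delta> > 0" "K \<ge> 0" using r \<delta> by (auto simp: K_def)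
    show "\<bar>F (x + h)\<bar> \<noteq> \<infinity> \<and> real_of_ereal (F (x + h)) - real_of_ereal (F x) - l h \<le> K * (nrm X h)\<^sup>2"
      if "h \<in> elems X" "nrm X h < min r \<delta>" for h
      using bound[OF that] fin[of h] that by (auto simp: g_def)
  qed
qed

lemma canonical_embedding_mem_bidual:
  assumes "seminormed X" and u: "u \<in> elems X"
  shows "canonical_embedding X u \<in> elems (dual (dual X))"
proof -
  interpret seminormed X by fact
  interpret D: seminormed "dual X" by (rule seminormed_dual)
  show ?thesis
  proof (rule dualI[where C="nrm X u"])
    fix \<phi> assume "\<phi> \<in> elems (dual X)"
    then show "\<bar>canonical_embedding X u \<phi>\<bar> \<le> nrm X u * nrm (dual X) \<phi>"
      using dual_le[of \<phi> u] u by (simp add: canonical_embedding_def mult.commute)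
  qed (auto simp: canonical_embedding_def)
qed

text \<open>
  Equality holds in the Fenchel-Young inequality for \<open>\<eta>\<close> and \<open>u\<close>, while the inequality for \<open>\<eta> + \<xi>\<close>
  and \<open>u\<close> is general; the difference says that \<open>u\<close> is a subgradient of the conjugate at \<open>\<eta>\<close>.
\<close>

lemma subdifferential_conjugate:
  assumes "seminormed X" and R: "proper_on X R" and u: "u \<in> elems X"
    and \<eta>: "\<eta> \<in> subdifferential X R u"
  shows "fenchel_conjugate X R \<eta> + ereal (\<xi> u) \<le> fenchel_conjugate X R (\<eta> + \<xi>)"
proof -
  interpret seminormed X by fact
  have \<eta>X: "\<eta> \<in> elems (dual X)" and sub: "\<And>v. v \<in> elems X \<Longrightarrow> R u + ereal (\<eta> v - \<eta> u) \<le> R v"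
    using \<eta> u by (auto simp: subdifferential_def dual_diff)
  obtain v where v: "v \<in> elems X" "R v \<noteq> \<infinity>" using R by (auto simp: proper_on_def)
  have "R u \<noteq> \<infinity>" using sub[OF v(1)] v(2) by auto
  then obtain a where a: "R u = ereal a" using R u by (cases "R u") (auto simp: proper_on_def)
  have "fenchel_conjugate X R \<eta> \<le> ereal (\<eta> u - a)"
    unfolding fenchel_conjugate_def
  proof (rule SUP_least)
    fix v assume "v \<in> elems X"
    then show "ereal (\<eta> v) - R v \<le> ereal (\<eta> u - a)"
      using sub[of v] R by (cases "R v") (auto simp: a proper_on_def)
  qed
  then have "fenchel_conjugate X R \<eta> + ereal (\<xi> u) \<le> ereal (\<eta> u - a) + ereal (\<xi> u)"
    by (rule add_right_mono)
  also have "\<dots> = ereal ((\<eta> + \<xi>) u) - R u" by (simp add: a)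
  also have "\<dots> \<le> fenchel_conjugate X R (\<eta> + \<xi>)"
    unfolding fenchel_conjugate_def by (rule SUP_upper[OF u])
  finally show ?thesis .
qed

section \<open>Adjoint operators and the range of the biadjoint\<close>

lemma dual_op_mem_dual:
  assumes X: "seminormed X" and Y: "seminormed Y" and T: "linear_op X Y T"
    and B: "\<And>u. u \<in> elems X \<Longrightarrow> nrm Y (T u) \<le> B * nrm X u" and \<psi>: "\<psi> \<in> elems (dual Y)"
  shows "dual_op X T \<psi> \<in> elems (dual X)"
proof -
  interpret X: seminormed X by fact
  interpret Y: seminormed Y by fact
  have TY: "T u \<in> elems Y" if "u \<in> elems X" for u
    using T that by (auto simp: linear_op_def)
  show ?thesis
  proof (rule dualI[where C="nrm (dual Y) \<psi> * B"])
    fix u v assume uv: "u \<in> elems X" "v \<in> elems X"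
    then have "nrm Y (T (u + v) - (T u + T v)) = 0" using T by (auto simp: linear_op_def)
    then have "\<psi> (T (u + v)) = \<psi> (T u + T v)" using TY uv by (intro Y.dual_cong[OF \<psi>]) auto
    then show "dual_op X T \<psi> (u + v) = dual_op X T \<psi> u + dual_op X T \<psi> v"
      using uv TY by (simp add: dual_op_def dual_add[OF \<psi>])
  next
    fix c u assume u: "u \<in> elems X"
    then have "nrm Y (T (c *\<^sub>R u) - c *\<^sub>R T u) = 0" using T by (auto simp: linear_op_def)
    then have "\<psi> (T (c *\<^sub>R u)) = \<psi> (c *\<^sub>R T u)" using TY u by (intro Y.dual_cong[OF \<psi>]) auto
    then show "dual_op X T \<psi> (c *\<^sub>R u) = c * dual_op X T \<psi> u"
      using u TY by (simp add: dual_op_def dual_scaleR[OF \<psi>])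
  next
    fix u assume u: "u \<in> elems X"
    have "\<bar>\<psi> (T u)\<bar> \<le> nrm (dual Y) \<psi> * nrm Y (T u)" by (rule Y.dual_le[OF \<psi> TY[OF u]])
    also have "\<dots> \<le> nrm (dual Y) \<psi> * (B * nrm X u)"
      by (intro mult_left_mono B u Y.nrm_dual_nonneg \<psi>)
    finally show "\<bar>dual_op X T \<psi> u\<bar> \<le> nrm (dual Y) \<psi> * B * nrm X u"
      using u by (simp add: dual_op_def mult.assoc)
  qed (simp add: dual_op_def)
qed

lemma dual_op_add: "dual_op X T (\<phi> + \<psi>) = dual_op X T \<phi> + dual_op X T \<psi>"
  and dual_op_diff: "dual_op X T (\<phi> - \<psi>) = dual_op X T \<phi> - dual_op X T \<psi>"
  and dual_op_scaleR: "dual_op X T (c *\<^sub>R \<psi>) = c *\<^sub>R dual_op X T \<psi>"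
  by (auto simp: dual_op_def fun_eq_iff)

text \<open>
  The functional \<open>T\<^sup>* \<psi> \<mapsto> \<psi> w\<close> on the range of the adjoint is given by its graph, to which
  \<open>dominated_extension\<close> applies directly.  The one-sided bound suffices, since \<open>\<psi>\<close> may be replaced
  by \<open>- \<psi>\<close>.
\<close>

theorem canonical_embedding_in_range_bidual_op:
  assumes X: "seminormed X" and Y: "seminormed Y" and T: "linear_op X Y T"
    and B: "\<And>u. u \<in> elems X \<Longrightarrow> nrm Y (T u) \<le> B * nrm X u"
    and C: "C \<ge> 0" "\<And>\<psi>. \<psi> \<in> elems (dual Y) \<Longrightarrow> \<psi> w \<le> C * nrm (dual X) (dual_op X T \<psi>)"
  shows "canonical_embedding Y w \<in> bidual_op X Y T ` elems (dual (dual X))"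
proof -
  interpret DX: seminormed "dual X" using X by (rule seminormed.seminormed_dual)
  interpret DY: seminormed "dual Y" using Y by (rule seminormed.seminormed_dual)
  have adj: "dual_op X T \<psi> \<in> elems (dual X)" if "\<psi> \<in> elems (dual Y)" for \<psi>
    using dual_op_mem_dual[OF X Y T B that] .
  define G where "G = (\<lambda>\<psi>. (dual_op X T \<psi>, \<psi> w)) ` elems (dual Y)"
  have subG: "subspace G"
  proof (rule subspaceI)
    have "(0, 0) = (dual_op X T 0, 0 w)" by (auto simp: dual_op_def fun_eq_iff)
    then show "0 \<in> G" unfolding G_def zero_prod_def using DY.zero_mem by blast
  next
    fix x y assume "x \<in> G" "y \<in> G"
    then obtain \<phi> \<psi> where *: "\<phi> \<in> elems (dual Y)" "\<psi> \<in> elems (dual Y)"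
      "x = (dual_op X T \<phi>, \<phi> w)" "y = (dual_op X T \<psi>, \<psi> w)" by (auto simp: G_def)
    then show "x + y \<in> G"
      unfolding G_def by (intro image_eqI[of _ _ "\<phi> + \<psi>"]) (auto simp: dual_op_add)
  next
    fix c x assume "x \<in> G"
    then obtain \<phi> where *: "\<phi> \<in> elems (dual Y)" "x = (dual_op X T \<phi>, \<phi> w)" by (auto simp: G_def)
    then show "c *\<^sub>R x \<in> G"
      unfolding G_def by (intro image_eqI[of _ _ "c *\<^sub>R \<phi>"]) (auto simp: dual_op_scaleR)
  qed
  have G_le: "x \<in> elems (dual X) \<and> a \<le> C * nrm (dual X) x" if "(x, a) \<in> G" for x a
    using that adj C(2) by (auto simp: G_def)
  have q_add: "C * nrm (dual X) (x + y) \<le> C * nrm (dual X) x + C * nrm (dual X) y"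
    if "x \<in> elems (dual X)" "y \<in> elems (dual X)" for x y
    using mult_left_mono[OF DX.nrm_triangle[OF that] C(1)] by (simp add: distrib_left)
  have q_scale: "C * nrm (dual X) (c *\<^sub>R x) = c * (C * nrm (dual X) x)"
    if "x \<in> elems (dual X)" "0 \<le> c" for c x
    using that by (simp add: DX.nrm_scaleR)
  obtain g where g: "\<And>x y. \<lbrakk>x \<in> elems (dual X); y \<in> elems (dual X)\<rbrakk> \<Longrightarrow> g (x + y) = g x + g y"
      "\<And>c x. x \<in> elems (dual X) \<Longrightarrow> g (c *\<^sub>R x) = c * g x"
      "\<And>x. x \<in> elems (dual X) \<Longrightarrow> g x \<le> C * nrm (dual X) x"
      "\<And>x a. (x, a) \<in> G \<Longrightarrow> g x = a"
    using dominated_extension[where q="\<lambda>x. C * nrm (dual X) x",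
        OF DX.subspace_elems q_add q_scale subG G_le] by blast
  define v where "v \<xi> = (if \<xi> \<in> elems (dual X) then g \<xi> else 0)" for \<xi>
  have "v \<in> elems (dual (dual X))"
  proof (rule dualI[where C=C])
    fix x assume x: "x \<in> elems (dual X)"
    then have "- x \<in> elems (dual X)" by (rule subspace_neg[OF DX.subspace_elems])
    from g(3)[OF this] g(3)[OF x] show "\<bar>v x\<bar> \<le> C * nrm (dual X) x"
      using x g(2)[OF x, of "-1"] DX.nrm_minus[OF x] by (auto simp: v_def)
  qed (auto simp: v_def g)
  moreover have "bidual_op X Y T v = canonical_embedding Y w"
    using adj g(4) by (auto simp: bidual_op_def dual_op_def[of "dual Y"] canonical_embedding_def v_def G_def fun_eq_iff)
  ultimately show ?thesis by (metis imageI)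
qed

lemma Linf_functional_mem_dual:
  assumes \<Gamma>: "\<Gamma> \<in> lmeasurable" and p: "p \<in> elems (Linf \<Gamma>)"
  shows "Linf_functional \<Gamma> p \<in> elems (dual (Linf \<Gamma>))"
proof -
  interpret L: seminormed "Linf \<Gamma>" by (rule seminormed_Linf)
  have int: "integrable (lebesgue_on \<Gamma>) (\<lambda>t. p t * z t)" if "z \<in> elems (Linf \<Gamma>)" for z
    by (rule Linf_integrable[OF \<Gamma> Linf_mult[OF p that]])
  show ?thesis
  proof (rule dualI[where C="\<integral>t. \<bar>p t\<bar> \<partial>lebesgue_on \<Gamma>"])
    fix z assume "z \<in> elems (Linf \<Gamma>)"
    then show "\<bar>Linf_functional \<Gamma> p z\<bar> \<le> (\<integral>t. \<bar>p t\<bar> \<partial>lebesgue_on \<Gamma>) * nrm (Linf \<Gamma>) z"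
      using Linf_pairing_le[OF \<Gamma> p] by (simp add: Linf_functional_def)
  next
    fix z z' assume "z \<in> elems (Linf \<Gamma>)" "z' \<in> elems (Linf \<Gamma>)"
    then show "Linf_functional \<Gamma> p (z + z') = Linf_functional \<Gamma> p z + Linf_functional \<Gamma> p z'"
      using int by (simp add: Linf_functional_def distrib_left)
  next
    fix c z assume "z \<in> elems (Linf \<Gamma>)"
    then show "Linf_functional \<Gamma> p (c *\<^sub>R z) = c * Linf_functional \<Gamma> p z"
      by (simp add: Linf_functional_def mult.left_commute)
  qed (simp add: Linf_functional_def)
qed

text \<open>
  The weak-* approximation of \<open>\<psi>\<close> by densities becomes a norm approximation after applying the adjoint
  of the compact operator \<open>A\<close>: it is enough to control \<open>\<psi>\<close> on a finite net of the image of the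
  unit ball, because the densities have norm at most that of \<open>\<psi>\<close>.  Including \<open>w\<close> in the net makes
  both sides of the inequality converge.
\<close>

theorem dual_bound_from_densities:
  assumes X: "seminormed X" and \<Gamma>: "\<Gamma> \<in> lmeasurable"
    and A: "linear_op X (Linf \<Gamma>) A" "compact_op X (Linf \<Gamma>) A"
    and w: "w \<in> elems (Linf \<Gamma>)" and C: "C \<ge> 0"
    and bound: "\<And>p. p \<in> elems (Linf \<Gamma>) \<Longrightarrow>
      (\<integral>t. p t * w t \<partial>lebesgue_on \<Gamma>) \<le> C * nrm (dual X) (dual_op X A (Linf_functional \<Gamma> p))"
    and \<psi>: "\<psi> \<in> elems (dual (Linf \<Gamma>))"
  shows "\<psi> w \<le> C * nrm (dual X) (dual_op X A \<psi>)"
proof -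
  interpret X: seminormed X by fact
  interpret DX: seminormed "dual X" by (rule X.seminormed_dual)
  interpret L: seminormed "Linf \<Gamma>" by (rule seminormed_Linf)
  let ?N = "nrm (dual (Linf \<Gamma>)) \<psi>"
  have N: "?N \<ge> 0" by (rule L.nrm_dual_nonneg[OF \<psi>])
  obtain B where B: "\<And>u. u \<in> elems X \<Longrightarrow> nrm (Linf \<Gamma>) (A u) \<le> B * nrm X u"
    using compact_op_imp_bounded[OF X seminormed_Linf A] by blast
  note adj = dual_op_mem_dual[OF X seminormed_Linf A(1) B]
  have AL: "A u \<in> elems (Linf \<Gamma>)" if "u \<in> elems X" for u
    using A(1) that by (auto simp: linear_op_def)
  have approx: "\<psi> w \<le> C * nrm (dual X) (dual_op X A \<psi>) + (C * (2 * ?N + 1) + 1) * \<delta>" if \<delta>: "\<delta> > 0" for \<delta>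
  proof -
    obtain F where F: "finite F" "F \<subseteq> elems (Linf \<Gamma>)"
      and net: "\<And>u. u \<in> elems X \<Longrightarrow> nrm X u \<le> 1 \<Longrightarrow> \<exists>y\<in>F. nrm (Linf \<Gamma>) (A u - y) < \<delta>"
      using compact_op_totally_bounded[OF X seminormed_Linf A \<delta>] by blast
    have wF: "finite (insert w F)" "insert w F \<subseteq> elems (Linf \<Gamma>)" using F w by auto
    obtain p where p: "p \<in> elems (Linf \<Gamma>)"
      and p_le: "\<And>z. z \<in> elems (Linf \<Gamma>) \<Longrightarrow> \<bar>\<integral>t. p t * z t \<partial>lebesgue_on \<Gamma>\<bar> \<le> ?N * nrm (Linf \<Gamma>) z"
      and close: "\<And>y. y \<in> insert w F \<Longrightarrow> \<bar>(\<integral>t. p t * y t \<partial>lebesgue_on \<Gamma>) - \<psi> y\<bar> \<le> \<delta>"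
      using dual_Linf_approx_by_density[OF \<Gamma> \<psi> wF \<delta>] by blast
    define \<pi> where "\<pi> = Linf_functional \<Gamma> p"
    have \<pi>: "\<pi> \<in> elems (dual (Linf \<Gamma>))" unfolding \<pi>_def by (rule Linf_functional_mem_dual[OF \<Gamma> p])
    have \<pi>_eq: "\<pi> z = (\<integral>t. p t * z t \<partial>lebesgue_on \<Gamma>)" if "z \<in> elems (Linf \<Gamma>)" for z
      using that by (simp add: \<pi>_def Linf_functional_def)
    have near: "nrm (dual X) (dual_op X A \<pi> - dual_op X A \<psi>) \<le> (2 * ?N + 1) * \<delta>"
    proof (rule X.nrm_dual_le)
      fix u assume u: "u \<in> elems X" "nrm X u \<le> 1"
      obtain y where y: "y \<in> F" "nrm (Linf \<Gamma>) (A u - y) < \<delta>" using net[OF u] by blast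
      have yL: "y \<in> elems (Linf \<Gamma>)" using y F by blast
      have d: "A u - y \<in> elems (Linf \<Gamma>)" using AL[OF u(1)] yL by simp
      have le: "?N * nrm (Linf \<Gamma>) (A u - y) \<le> ?N * \<delta>"
        using y N by (intro mult_left_mono) auto
      have 1: "\<bar>\<pi> (A u - y)\<bar> \<le> ?N * \<delta>" using p_le[OF d] le by (simp add: \<pi>_eq[OF d])
      have 2: "\<bar>\<psi> (A u - y)\<bar> \<le> ?N * \<delta>" using L.dual_le[OF \<psi> d] le by linarith
      have 3: "\<bar>\<pi> y - \<psi> y\<bar> \<le> \<delta>" using close[of y] y by (simp add: \<pi>_eq[OF yL])
      have "\<pi> (A u) - \<psi> (A u) = \<pi> (A u - y) - \<psi> (A u - y) + (\<pi> y - \<psi> y)"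
        using L.dual_diff[OF \<pi> AL[OF u(1)] yL] L.dual_diff[OF \<psi> AL[OF u(1)] yL] by simp
      then have "\<bar>\<pi> (A u) - \<psi> (A u)\<bar> \<le> (2 * ?N + 1) * \<delta>"
        using 1 2 3 by (simp add: distrib_right)
      then show "\<bar>(dual_op X A \<pi> - dual_op X A \<psi>) u\<bar> \<le> (2 * ?N + 1) * \<delta>"
        using u by (simp add: dual_op_def)
    qed
    have "\<psi> w \<le> (\<integral>t. p t * w t \<partial>lebesgue_on \<Gamma>) + \<delta>" using close[of w] by simp
    also have "\<dots> \<le> C * nrm (dual X) (dual_op X A \<pi>) + \<delta>" using bound[OF p] by (simp add: \<pi>_def)
    also have "\<dots> \<le> C * ((2 * ?N + 1) * \<delta> + nrm (dual X) (dual_op X A \<psi>)) + \<delta>"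
      using DX.nrm_triangle_diff[OF adj[OF _ \<pi>] adj[OF _ \<psi>]] near C
      by (intro add_right_mono mult_left_mono) linarith+
    finally show ?thesis by (simp add: algebra_simps)
  qed
  show ?thesis
  proof (rule field_le_epsilon)
    fix e :: real assume e: "e > 0"
    define K where "K = C * (2 * ?N + 1) + 1"
    have K: "K > 0" using C N by (simp add: K_def add_nonneg_pos)
    from approx[of "e / K"] e K
    show "\<psi> w \<le> C * nrm (dual X) (dual_op X A \<psi>) + e" by (simp add: K_def[symmetric])
  qed
qed

section \<open>From the variational inequality to a linear bound\<close>

text \<open>
  Here \<open>d s\<close> stands for the Bregman distance at the test function with parameter \<open>s\<close>, \<open>a\<close> for the norm
  \<open>\<parallel>A\<^sup>* p\<parallel>\<close> and \<open>I\<close> for \<open>\<integral> p w\<close>.  The square root of a quantity quadratic in \<open>s\<close> is linear in \<open>s\<close>, which is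
  why exactly this rate yields a bound with the factor \<open>s\<close> on both sides.
\<close>

lemma square_root_rate_imp_linear_bound:
  fixes \<Phi> :: "real \<Rightarrow> real"
  assumes \<Phi>: "\<Phi> \<sim>[at_right 0] (\<lambda>t. t powr (1 / 2))" "\<Phi> 0 = 0"
  obtains c where "c \<ge> 0"
    and "\<And>I a d r K. \<lbrakk>0 \<le> a; 0 < r; 0 \<le> K;
      \<And>s. \<lbrakk>0 < s; s * a < r\<rbrakk> \<Longrightarrow> 0 \<le> d s \<and> d s \<le> K * (s * a)\<^sup>2 \<and> s * I \<le> \<Phi> (d s)\<rbrakk> \<Longrightarrow> I \<le> c * sqrt K * a"
proof -
  from asymp_equiv_imp_bigo[OF \<Phi>(1)]
  obtain c where c: "c > 0" "eventually (\<lambda>t. norm (\<Phi> t) \<le> c * norm (t powr (1 / 2))) (at_right 0)"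
    by (elim landau_o.bigE)
  then obtain \<tau> where \<tau>: "\<tau> > 0" "\<And>t. 0 < t \<Longrightarrow> t < \<tau> \<Longrightarrow> \<bar>\<Phi> t\<bar> \<le> c * sqrt t"
    by (auto simp: eventually_at_right_field powr_half_sqrt)
  have \<Phi>_le: "\<Phi> t \<le> c * sqrt t" if "0 \<le> t" "t < \<tau>" for t
    using \<tau>(2)[of t] that \<Phi>(2) by (cases "t = 0") auto
  show ?thesis
  proof (rule that[of c])
    show "c \<ge> 0" using c by simp
    fix I a r K :: real and d :: "real \<Rightarrow> real"
    assume a: "0 \<le> a" and r: "0 < r" and K: "0 \<le> K"
      and d: "\<And>s. \<lbrakk>0 < s; s * a < r\<rbrakk> \<Longrightarrow> 0 \<le> d s \<and> d s \<le> K * (s * a)\<^sup>2 \<and> s * I \<le> \<Phi> (d s)"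
    have "((\<lambda>s. s * a) \<longlongrightarrow> 0 * a) (at_right 0)" "((\<lambda>s. K * (s * a)\<^sup>2) \<longlongrightarrow> K * (0 * a)\<^sup>2) (at_right 0)"
      by (intro tendsto_intros)+
    then have "eventually (\<lambda>s. s * a < r) (at_right 0)" "eventually (\<lambda>s. K * (s * a)\<^sup>2 < \<tau>) (at_right 0)"
      using r \<tau>(1) by (auto dest: order_tendstoD(2))
    moreover have "eventually (\<lambda>s::real. s > 0) (at_right 0)" by (rule eventually_at_right_less)
    ultimately have "eventually (\<lambda>s. s > 0 \<and> s * a < r \<and> K * (s * a)\<^sup>2 < \<tau>) (at_right 0)"
      by eventually_elim simp
    then obtain s where s: "s > 0" "s * a < r" "K * (s * a)\<^sup>2 < \<tau>"
      using eventually_happens'[OF trivial_limit_at_right_real] by blast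
    have "s * I \<le> c * sqrt (d s)" using d[OF s(1,2)] \<Phi>_le[of "d s"] s(3) by linarith
    also have "\<dots> \<le> c * sqrt (K * (s * a)\<^sup>2)" using d[OF s(1,2)] c by (intro mult_left_mono) auto
    also have "\<dots> = s * (c * sqrt K * a)" using s a by (simp add: real_sqrt_mult abs_mult)
    finally show "I \<le> c * sqrt K * a" using s(1) by simp
  qed
qed

theorem theorem5p6:
  fixes \<Omega> \<Gamma> :: "(real ^ 2) set"
    and A :: "(real ^ 2 \<Rightarrow> real) \<Rightarrow> (real ^ 2 \<Rightarrow> real)"
    and f p\<^sub>d u\<^sub>d :: "real ^ 2 \<Rightarrow> real"
    and c\<^sub>1 c\<^sub>2 :: real
    and R :: "(real ^ 2 \<Rightarrow> real) \<Rightarrow> ereal"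
    and \<Phi> :: "real \<Rightarrow> real"
  defines "Rstar \<equiv> fenchel_conjugate (L1 \<Omega>) R"
    and "Astar \<equiv> \<lambda>p. dual_op (L1 \<Omega>) A (Linf_functional \<Gamma> p)"
  assumes "bounded \<Omega>" "\<Omega> \<in> sets lebesgue" "bounded \<Gamma>" "\<Gamma> \<in> sets lebesgue"
    and A: "linear_op (L1 \<Omega>) (Linf \<Gamma>) A" "compact_op (L1 \<Omega>) (Linf \<Gamma>) A"
      "ill_posed (L1 \<Omega>) (Linf \<Gamma>) A"
    and f: "f \<in> elems (Linf \<Gamma>)" "c\<^sub>1 > 0" "c\<^sub>2 > 0"
      "AE t in lebesgue_on \<Gamma>. c\<^sub>1 \<le> f t \<and> f t \<le> c\<^sub>2"
    and R: "proper_on (L1 \<Omega>) R" "convex_functional (L1 \<Omega>) R" "lsc_functional (L1 \<Omega>) R"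
    and u\<^sub>d: "u\<^sub>d \<in> elems (L1 \<Omega>)" "AE t in lebesgue_on \<Gamma>. A u\<^sub>d t = f t"
      "\<forall>u\<in>elems (L1 \<Omega>). (AE t in lebesgue_on \<Gamma>. A u t = f t) \<longrightarrow> R u\<^sub>d \<le> R u"
    and p\<^sub>d: "p\<^sub>d \<in> elems (Linf \<Gamma>)" "Astar p\<^sub>d \<in> subdifferential (L1 \<Omega>) R u\<^sub>d"
    and \<Phi>: "\<Phi> \<in> {0..} \<rightarrow> {0..}" "strict_mono_on {0..} \<Phi>" "continuous_on {0..} \<Phi>"
      "concave_on {0..} \<Phi>" "\<Phi> 0 = 0"
    and variational_inequality:
      "\<forall>p\<in>elems (Linf \<Gamma>). bregman_dist Rstar u\<^sub>d (Astar p) (Astar p\<^sub>d) \<noteq> \<infinity> \<longrightarrow>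
        (\<integral>t. f t * p\<^sub>d t * (p\<^sub>d t - p t) \<partial>lebesgue_on \<Gamma>)
          \<le> \<Phi> (real_of_ereal (bregman_dist Rstar u\<^sub>d (Astar p) (Astar p\<^sub>d)))"
    and "twice_frechet_differentiable (dual (L1 \<Omega>)) Rstar (Astar p\<^sub>d)"
    and "\<Phi> \<sim>[at_right 0] (\<lambda>t. t powr (1 / 2))"
  shows "canonical_embedding (Linf \<Gamma>) (\<lambda>t. f t * p\<^sub>d t)
    \<in> bidual_op (L1 \<Omega>) (Linf \<Gamma>) A ` elems (dual (dual (L1 \<Omega>)))"
proof -
  let ?X = "L1 \<Omega>" and ?Y = "Linf \<Gamma>"
  let ?w = "\<lambda>t. f t * p\<^sub>d t"
  have \<Gamma>: "\<Gamma> \<in> lmeasurable"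
    using \<open>bounded \<Gamma>\<close> \<open>\<Gamma> \<in> sets lebesgue\<close> by (rule bounded_set_imp_lmeasurable)
  have X: "seminormed ?X" by (rule seminormed_L1)
  have Y: "seminormed ?Y" by (rule seminormed_Linf)
  interpret X: seminormed ?X by (rule X)
  interpret Y: seminormed ?Y by (rule Y)
  have DX: "seminormed (dual ?X)" by (rule X.seminormed_dual)
  interpret DX: seminormed "dual ?X" by (rule DX)
  obtain B where B: "\<And>u. u \<in> elems ?X \<Longrightarrow> nrm ?Y (A u) \<le> B * nrm ?X u"
    using compact_op_imp_bounded[OF X Y A(1,2)] by blast
  have Astar_mem: "Astar p \<in> elems (dual ?X)" if "p \<in> elems ?Y" for p
    unfolding Astar_def by (rule dual_op_mem_dual[OF X Y A(1) B Linf_functional_mem_dual[OF \<Gamma> that]])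
  have w: "?w \<in> elems ?Y" by (rule Linf_mult[OF f(1) p\<^sub>d(1)])
  define \<eta> where "\<eta> = Astar p\<^sub>d"
  have \<eta>: "\<eta> \<in> elems (dual ?X)" unfolding \<eta>_def by (rule Astar_mem[OF p\<^sub>d(1)])
  have sub: "Rstar \<eta> + ereal (canonical_embedding ?X u\<^sub>d h) \<le> Rstar (\<eta> + h)"
    if "h \<in> elems (dual ?X)" for h
    using subdifferential_conjugate[OF X R(1) u\<^sub>d(1), of \<eta> h] p\<^sub>d(2) that
    by (simp add: Rstar_def \<eta>_def canonical_embedding_def)
  have diff: "twice_frechet_differentiable (dual ?X) Rstar \<eta>" unfolding \<eta>_def by fact
  obtain K r where r: "r > 0" and K: "K \<ge> 0"
    and quad: "\<And>h. h \<in> elems (dual ?X) \<Longrightarrow> nrm (dual ?X) h < r \<Longrightarrow> \<bar>Rstar (\<eta> + h)\<bar> \<noteq> \<infinity> \<and>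
      real_of_ereal (Rstar (\<eta> + h)) - real_of_ereal (Rstar \<eta>) - canonical_embedding ?X u\<^sub>d h
        \<le> K * (nrm (dual ?X) h)\<^sup>2"
    using quadratic_bound_at_subgradient[where F=Rstar, OF DX \<eta> diff canonical_embedding_mem_bidual[OF X u\<^sub>d(1)] sub]
    by blast
  have fin: "\<bar>Rstar \<eta>\<bar> \<noteq> \<infinity>" using quad[of 0] r by simp
  have bregman: "\<exists>d. bregman_dist Rstar u\<^sub>d (\<eta> + h) \<eta> = ereal d \<and> 0 \<le> d \<and> d \<le> K * (nrm (dual ?X) h)\<^sup>2"
    if h: "h \<in> elems (dual ?X)" "nrm (dual ?X) h < r" for h
    using quad[OF h] fin sub[OF h(1)] h(1)
    by (cases "Rstar \<eta>"; cases "Rstar (\<eta> + h)") (auto simp: bregman_dist_def canonical_embedding_def)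
  obtain c where c: "c \<ge> 0"
    and rate: "\<And>I a d r K. \<lbrakk>0 \<le> a; 0 < r; 0 \<le> K;
      \<And>s. \<lbrakk>0 < s; s * a < r\<rbrakk> \<Longrightarrow> 0 \<le> d s \<and> d s \<le> K * (s * a)\<^sup>2 \<and> s * I \<le> \<Phi> (d s)\<rbrakk> \<Longrightarrow> I \<le> c * sqrt K * a"
    using square_root_rate_imp_linear_bound[OF \<open>\<Phi> \<sim>[at_right 0] (\<lambda>t. t powr (1 / 2))\<close> \<Phi>(5)] by blast
  have bound: "(\<integral>t. p t * ?w t \<partial>lebesgue_on \<Gamma>) \<le> c * sqrt K * nrm (dual ?X) (Astar p)"
    if p: "p \<in> elems ?Y" for p
  proof (rule rate[OF DX.nrm_nonneg[OF Astar_mem[OF p]] r K])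
    fix s :: real assume s: "0 < s" "s * nrm (dual ?X) (Astar p) < r"
    \<comment> \<open>The test function \<open>?q\<close> moves the dual variable from \<open>\<eta>\<close> by \<open>?h\<close>, of norm proportional to \<open>s\<close>.\<close>
    let ?q = "p\<^sub>d - s *\<^sub>R p" and ?h = "- (s *\<^sub>R Astar p)"
    have q: "?q \<in> elems ?Y" using p p\<^sub>d(1) by simp
    have h: "?h \<in> elems (dual ?X)"
      by (intro subspace_neg[OF DX.subspace_elems] DX.scaleR_mem Astar_mem p)
    have nh: "nrm (dual ?X) ?h = s * nrm (dual ?X) (Astar p)"
      using s(1) Astar_mem[OF p] by (simp add: DX.nrm_minus DX.nrm_scaleR)
    have int: "integrable (lebesgue_on \<Gamma>) (\<lambda>t. g t * z t)" if "g \<in> elems ?Y" "z \<in> elems ?Y" for g z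
      by (rule Linf_integrable[OF \<Gamma> Linf_mult[OF that]])
    have "Linf_functional \<Gamma> ?q = Linf_functional \<Gamma> p\<^sub>d - s *\<^sub>R Linf_functional \<Gamma> p"
    proof
      fix z
      show "Linf_functional \<Gamma> ?q z = (Linf_functional \<Gamma> p\<^sub>d - s *\<^sub>R Linf_functional \<Gamma> p) z"
        using int[OF p\<^sub>d(1)] int[OF p]
        by (cases "z \<in> elems ?Y") (simp_all add: Linf_functional_def left_diff_distrib mult.assoc)
    qed
    then have Aq: "Astar ?q = \<eta> + ?h"
      by (simp add: Astar_def \<eta>_def dual_op_diff dual_op_scaleR)
    obtain d where d: "bregman_dist Rstar u\<^sub>d (Astar ?q) (Astar p\<^sub>d) = ereal d"
      "0 \<le> d" "d \<le> K * (s * nrm (dual ?X) (Astar p))\<^sup>2"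
      using bregman[OF h] s(2) by (auto simp: nh Aq \<eta>_def[symmetric])
    have "(\<integral>t. f t * p\<^sub>d t * (p\<^sub>d t - ?q t) \<partial>lebesgue_on \<Gamma>) \<le> \<Phi> d"
      using variational_inequality[rule_format, OF q] d(1) by simp
    moreover have "(\<integral>t. f t * p\<^sub>d t * (p\<^sub>d t - ?q t) \<partial>lebesgue_on \<Gamma>)
      = (\<integral>t. s * (p t * ?w t) \<partial>lebesgue_on \<Gamma>)"
      by (intro Bochner_Integration.integral_cong) (auto simp: ac_simps)
    ultimately show "0 \<le> real_of_ereal (bregman_dist Rstar u\<^sub>d (Astar ?q) (Astar p\<^sub>d)) \<and>
      real_of_ereal (bregman_dist Rstar u\<^sub>d (Astar ?q) (Astar p\<^sub>d)) \<le> K * (s * nrm (dual ?X) (Astar p))\<^sup>2 \<and>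
      s * (\<integral>t. p t * ?w t \<partial>lebesgue_on \<Gamma>)
        \<le> \<Phi> (real_of_ereal (bregman_dist Rstar u\<^sub>d (Astar ?q) (Astar p\<^sub>d)))"
      using d by simp
  qed
  have C: "c * sqrt K \<ge> 0" using c K by simp
  show ?thesis
    by (rule canonical_embedding_in_range_bidual_op[OF X Y A(1) B C
          dual_bound_from_densities[OF X \<Gamma> A(1,2) w C bound[unfolded Astar_def]]])
qed

end
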